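(* For all $R,D\ge 1$ there exists a choice of parameters $(\gamma^*,\eta^*,\beta^* )$ such that the asymptotic competitive ratio of Forward-Looking BALANCE (FLB) with inspection-frequency scalar $\gamma^*$ and penalty parameters $(\eta^*,\beta^* )$ is at most $$\ln(RD)+3\ln\ln(R\vee D)+O(1).$$ Moreover, there exist instances involving a single server with $R,D\ge 1$ for which the asymptotic competitive ratio of any online algorithm (possibly fractional or randomized) against the optimal offline benchmark is at least $\ln(RD)+\Omega(1)$. As a corollary, $\mathcal{C}_{\textsc{log-limit}}(\mathrm{FLB})=\mathcal{C}^*_{\textsc{log-limit}}=1$.
   Context: Online job assignment problem: there are $n$ servers $[n]=\{1,\dots,n\}$; server $i$ has capacity $c_i\in\mathbb{N}$, and $c_{\min}=\min_i c_i$. Over a continuous horizon $[0,T]$, $m$ jobs arrive online at times $0\le t_1\le\dots\le t_m\le T$. A set $E\subseteq[n]\times[m]$ specifies compatibility, $N(j)=\{i:(i,j)\in E\}$. Each $(i,j)\in E$ has a per-period reward $r_{ij}\in[1,R]$ and a duration $d_{ij}\in[1,D]$ (real numbers), where $R,D\ge1$ are known to the algorithm. When job $j$ arrives, $N(j)$ and $\{r_{ij},d_{ij}\}_{i\in N(j)}$ are revealed and the algorithm must immediately and irrevocably assign $j$ to a server in $N(j)$ or leave it unassigned. A job $j$ assigned to server $i$ occupies one unit of capacity of $i$ from time $t_j$ until time $t_j+d_{ij}$ and yields reward $r_{ij}d_{ij}$. An assignment is feasible if at every time each server $i$ processes at most $c_i$ jobs. $\mathrm{OPT}(I)$ is the maximum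 total reward of a feasible assignment of instance $I$ computed knowing $I$ in advance; $\mathrm{ALG}(I)$ is the total reward of online algorithm ALG. With $\mathcal I(R,D,c_{\min})$ the instances with rewards in $[1,R]$, durations in $[1,D]$ and minimum capacity $c_{\min}$, ALG is asymptotically $\Gamma(R,D)$-competitive if $\limsup_{c_{\min}\to\infty}\sup_{I\in\mathcal I(R,D,c_{\min})}\mathrm{OPT}(I)/\mathbb{E}[\mathrm{ALG}(I)]\le\Gamma(R,D)$; the asymptotic competitive ratio is the best such bound. FLB with inspection-frequency scalar $\gamma\in[1,\infty)$ and penalty parameters $\eta\ge0,\beta\ge1$: let $\Psi(x)=\eta(\beta^{1-x}-1)$. For server $i$ and times $t\le\tau$, the projected available capacity is $\alpha_{i,t\to\tau}=1-\frac{1}{c_i}\,|\{j': t_{j'}<t,\ j'\text{ assigned to }i,\ t_{j'}+d_{ij'}>\tau\}|$. The inspection-time set is $\mathcal T_{ij}(\gamma)=\{\tau\in[t_j,t_j+d_{ij}):\tau=t_j+\ell/\gamma\text{ for some integer }\ell\ge0\}$. On arrival of job $j$, FLB computes for each $i\in N(j)$ the reduced reward $r_{ij}d_{ij}-\sum_{\tau\in\mathcal T_{ij}(\gamma)}\Psi(\alpha_{i,t_j\to\tau})$; if the maximum is positive it assigns $j$ to a maximizing server, otherwise $j$ is unassigned. For an online algorithm $\mathcal A$, $\mathcal C_{\textsc{log-limit}}(\mathcal A)$ is the smallest constant $C>0$ such that its asymptotic competitive ratio satisfies $\Gamma(R,D)=C\ln(RD)+o(\log(RD))$ (and $+\infty$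 if $\Gamma(R,D)=\omega(\log(RD))$); $\mathcal C^*_{\textsc{log-limit}}$ is the smallest value of $\mathcal C_{\textsc{log-limit}}(\mathcal A)$ over all online algorithms $\mathcal A$.
   Formalization: Jobs with equal arrival times are processed in index order (with t_{j'}<t taken literally, FLB could exceed capacities on simultaneous jobs), and ln ln(R∨D) is read as ln max(1, ln(R∨D)), since it is undefined at R=D=1 and tends to −∞ near it. *)

theory Defs
  imports "HOL-Probability.Probability"
begin

section \<open>Instances\<close>

text \<open>Servers are \<open>0, \<dots>, n - 1\<close> and jobs \<open>0, \<dots>, m - 1\<close>, the latter in order of arrival. A job
  maps each compatible server \<open>i\<close> to the pair \<open>(r, d)\<close> of its per-period reward and duration there,
  so that the edge set \<open>E\<close> and the neighbourhoods \<open>N(j)\<close> are given by the domains of these maps.\<close>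

record job =
  arrival :: real
  offer :: "nat \<rightharpoonup> real \<times> real"

record problem =
  capacities :: "nat list"
  horizon :: real
  jobs :: "job list"

definition num_servers :: "problem \<Rightarrow> nat" where
  "num_servers I = length (capacities I)"

definition num_jobs :: "problem \<Rightarrow> nat" where
  "num_jobs I = length (jobs I)"

definition cap :: "problem \<Rightarrow> nat \<Rightarrow> nat" where
  "cap I i = capacities I ! i"

definition time :: "problem \<Rightarrow> nat \<Rightarrow> real" where
  "time I j = arrival (jobs I ! j)"

definition nbrs :: "problem \<Rightarrow> nat \<Rightarrow> nat set" where
  "nbrs I j = dom (offer (jobs I ! j))"

definition rew :: "problem \<Rightarrow> nat \<Rightarrow> nat \<Rightarrow> real" where
  "rew I i j = fst (the (offer (jobs I ! j) i))"

definition dur :: "problem \<Rightarrow> nat \<Rightarrow> nat \<Rightarrow> real" where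
  "dur I i j = snd (the (offer (jobs I ! j) i))"

definition valid_problem :: "problem \<Rightarrow> bool" where
  "valid_problem I \<longleftrightarrow>
     num_servers I \<ge> 1 \<and> (\<forall>i<num_servers I. cap I i \<ge> 1) \<and>
     horizon I \<ge> 0 \<and>
     (\<forall>j<num_jobs I. 0 \<le> time I j \<and> time I j \<le> horizon I) \<and>
     (\<forall>j<num_jobs I. \<forall>k<j. time I k \<le> time I j) \<and>
     (\<forall>j<num_jobs I. nbrs I j \<subseteq> {..<num_servers I}) \<and>
     (\<forall>j<num_jobs I. \<forall>i\<in>nbrs I j. 1 \<le> rew I i j \<and> 1 \<le> dur I i j)"

definition problems :: "real \<Rightarrow> real \<Rightarrow> problem set" where
  "problems R D = {I. valid_problem I \<and>
     (\<forall>j<num_jobs I. \<forall>i\<in>nbrs I j. rew I i j \<le> R \<and> dur I i j \<le> D)}"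

definition c_min :: "problem \<Rightarrow> nat" where
  "c_min I = Min (cap I ` {..<num_servers I})"

section \<open>Assignments and the offline optimum\<close>

text \<open>\<open>a j = Some i\<close> assigns job \<open>j\<close> to server \<open>i\<close>, and \<open>a j = None\<close> leaves it unassigned; only the
  values at \<open>j < num_jobs I\<close> matter. Assigned jobs occupy their server during \<open>[t\<^sub>j, t\<^sub>j + d\<^sub>i\<^sub>j)\<close>.\<close>

definition active :: "problem \<Rightarrow> nat \<Rightarrow> real \<Rightarrow> nat set" where
  "active I i t = {j. j < num_jobs I \<and> i \<in> nbrs I j \<and> time I j \<le> t \<and> t < time I j + dur I i j}"

definition feasible :: "problem \<Rightarrow> (nat \<Rightarrow> nat option) \<Rightarrow> bool" where
  "feasible I a \<longleftrightarrow>
     (\<forall>j<num_jobs I. \<forall>i. a j = Some i \<longrightarrow> i \<in> nbrs I j) \<and>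
     (\<forall>i<num_servers I. \<forall>t. card {j \<in> active I i t. a j = Some i} \<le> cap I i)"

definition total_reward :: "problem \<Rightarrow> (nat \<Rightarrow> nat option) \<Rightarrow> real" where
  "total_reward I a =
     (\<Sum>j<num_jobs I. case a j of None \<Rightarrow> 0 | Some i \<Rightarrow> rew I i j * dur I i j)"

definition OPT :: "problem \<Rightarrow> real" where
  "OPT I = (SUP a\<in>{a. feasible I a}. total_reward I a)"

definition frac_feasible :: "problem \<Rightarrow> (nat \<Rightarrow> nat \<Rightarrow> real) \<Rightarrow> bool" where
  "frac_feasible I x \<longleftrightarrow>
     (\<forall>j<num_jobs I. (\<forall>i\<in>nbrs I j. 0 \<le> x j i) \<and> (\<Sum>i\<in>nbrs I j. x j i) \<le> 1) \<and>
     (\<forall>i<num_servers I. \<forall>t. (\<Sum>j\<in>active I i t. x j i) \<le> real (cap I i))"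

definition frac_reward :: "problem \<Rightarrow> (nat \<Rightarrow> nat \<Rightarrow> real) \<Rightarrow> real" where
  "frac_reward I x = (\<Sum>j<num_jobs I. \<Sum>i\<in>nbrs I j. rew I i j * dur I i j * x j i)"

section \<open>Online algorithms\<close>

text \<open>When job \<open>j\<close> arrives, an algorithm knows the servers, the horizon and jobs \<open>0, \<dots>, j\<close>, but
  neither the later jobs nor their number. Its earlier decisions (for a given random seed) are
  functions of this information, hence need not be passed as an argument.\<close>

definition revealed :: "problem \<Rightarrow> nat \<Rightarrow> problem" where
  "revealed I j = I\<lparr>jobs := take (Suc j) (jobs I)\<rparr>"

type_synonym policy = "problem \<Rightarrow> nat option"
type_synonym frac_policy = "problem \<Rightarrow> nat \<Rightarrow> real"

definition run :: "policy \<Rightarrow> problem \<Rightarrow> nat \<Rightarrow> nat option" where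
  "run p I j = p (revealed I j)"

definition frac_run :: "frac_policy \<Rightarrow> problem \<Rightarrow> nat \<Rightarrow> nat \<Rightarrow> real" where
  "frac_run q I j = q (revealed I j)"

text \<open>A randomized algorithm draws a seed from a probability space over \<open>'w\<close> and then follows the
  deterministic policy determined by the seed.\<close>

datatype 'w algorithm =
    Deterministic policy
  | Randomized "'w measure" "'w \<Rightarrow> policy"
  | Fractional frac_policy

fun online_algorithm :: "real \<Rightarrow> real \<Rightarrow> 'w algorithm \<Rightarrow> bool" where
  "online_algorithm R D (Deterministic p) \<longleftrightarrow> (\<forall>I\<in>problems R D. feasible I (run p I))"
| "online_algorithm R D (Randomized M p) \<longleftrightarrow>
     prob_space M \<and>
     (\<forall>I\<in>problems R D.
        (\<forall>j<num_jobs I. (\<lambda>w. run (p w) I j) \<in> measurable M (count_space UNIV)) \<and>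
        (AE w in M. feasible I (run (p w) I)))"
| "online_algorithm R D (Fractional q) \<longleftrightarrow> (\<forall>I\<in>problems R D. frac_feasible I (frac_run q I))"

fun ALG :: "'w algorithm \<Rightarrow> problem \<Rightarrow> real" where
  "ALG (Deterministic p) I = total_reward I (run p I)"
| "ALG (Randomized M p) I = (\<integral>w. total_reward I (run (p w) I) \<partial>M)"
| "ALG (Fractional q) I = frac_reward I (frac_run q I)"

text \<open>The quotient is taken in the extended reals, where \<open>x / 0 = \<infinity>\<close> for \<open>x > 0\<close> and \<open>0 / 0 = 0\<close>.\<close>

definition asymp_ratio_on :: "problem set \<Rightarrow> 'w algorithm \<Rightarrow> ereal" where
  "asymp_ratio_on P A =
     limsup (\<lambda>c. SUP I\<in>{I \<in> P. c_min I = c}. ereal (OPT I) / ereal (ALG A I))"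

definition asymp_ratio :: "'w algorithm \<Rightarrow> real \<Rightarrow> real \<Rightarrow> ereal" where
  "asymp_ratio A R D = asymp_ratio_on (problems R D) A"

definition single_server_problems :: "real \<Rightarrow> real \<Rightarrow> problem set" where
  "single_server_problems R D = {I \<in> problems R D. num_servers I = 1}"

section \<open>Forward-Looking BALANCE\<close>

definition Psi :: "real \<Rightarrow> real \<Rightarrow> real \<Rightarrow> real" where
  "Psi \<eta> \<beta> x = \<eta> * (\<beta> powr (1 - x) - 1)"

text \<open>The projected capacity of server \<open>i\<close> at time \<open>\<tau>\<close>, as seen on arrival of job \<open>j\<close>. Of several jobs
  with the same arrival time, those with smaller index count as having arrived earlier. (Comparing
  arrival times strictly would make simultaneous jobs invisible to each other, and FLB could then
  exceed the capacities.)\<close>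

definition proj_capacity :: "problem \<Rightarrow> (nat \<Rightarrow> nat option) \<Rightarrow> nat \<Rightarrow> nat \<Rightarrow> real \<Rightarrow> real" where
  "proj_capacity I a i j \<tau> =
     1 - real (card {k. k < j \<and> a k = Some i \<and> time I k + dur I i k > \<tau>}) / real (cap I i)"

definition inspection_times :: "real \<Rightarrow> problem \<Rightarrow> nat \<Rightarrow> nat \<Rightarrow> real set" where
  "inspection_times \<gamma> I i j =
     {\<tau>. time I j \<le> \<tau> \<and> \<tau> < time I j + dur I i j \<and> (\<exists>l::nat. \<tau> = time I j + real l / \<gamma>)}"

definition reduced_reward ::
  "real \<Rightarrow> real \<Rightarrow> real \<Rightarrow> problem \<Rightarrow> (nat \<Rightarrow> nat option) \<Rightarrow> nat \<Rightarrow> nat \<Rightarrow> real" where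
  "reduced_reward \<gamma> \<eta> \<beta> I a i j =
     rew I i j * dur I i j - (\<Sum>\<tau>\<in>inspection_times \<gamma> I i j. Psi \<eta> \<beta> (proj_capacity I a i j \<tau>))"

definition flb_decision ::
  "real \<Rightarrow> real \<Rightarrow> real \<Rightarrow> problem \<Rightarrow> (nat \<Rightarrow> nat option) \<Rightarrow> nat \<Rightarrow> bool" where
  "flb_decision \<gamma> \<eta> \<beta> I a j \<longleftrightarrow>
     (if \<exists>i\<in>nbrs I j. reduced_reward \<gamma> \<eta> \<beta> I a i j > 0
      then \<exists>i\<in>nbrs I j. a j = Some i \<and>
             (\<forall>k\<in>nbrs I j. reduced_reward \<gamma> \<eta> \<beta> I a k j \<le> reduced_reward \<gamma> \<eta> \<beta> I a i j)
      else a j = None)"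

text \<open>All implementations of FLB; they differ only in how ties between maximizing servers are
  broken.\<close>

definition FLB :: "real \<Rightarrow> real \<Rightarrow> real \<Rightarrow> policy set" where
  "FLB \<gamma> \<eta> \<beta> = {p. \<forall>I. valid_problem I \<longrightarrow> (\<forall>j<num_jobs I. flb_decision \<gamma> \<eta> \<beta> I (run p I) j)}"

section \<open>The logarithmic limit constant\<close>

text \<open>\<open>\<Gamma>(R, D) = C ln (R D) + o(log (R D))\<close> as \<open>R D \<rightarrow> \<infinity>\<close> over \<open>R, D \<ge> 1\<close>.\<close>

definition has_log_rate :: "(real \<Rightarrow> real \<Rightarrow> ereal) \<Rightarrow> real \<Rightarrow> bool" where
  "has_log_rate \<Gamma> C \<longleftrightarrow>
     (\<forall>\<epsilon>>0. \<exists>X. \<forall>R\<ge>1. \<forall>D\<ge>1. R * D \<ge> X \<longrightarrow>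
        \<bar>\<Gamma> R D - ereal (C * ln (R * D))\<bar> \<le> ereal (\<epsilon> * ln (R * D)))"

text \<open>As \<open>R\<close> and \<open>D\<close> are known in advance, an algorithm is here a family indexed by them. The infimum
  is \<open>\<infinity>\<close> if there is no such constant.\<close>

definition C_log_limit :: "(real \<Rightarrow> real \<Rightarrow> 'w algorithm) \<Rightarrow> ereal" where
  "C_log_limit A = Inf {ereal C |C. C > 0 \<and> has_log_rate (\<lambda>R D. asymp_ratio (A R D) R D) C}"

definition C_log_limit_star :: "'w itself \<Rightarrow> ereal" where
  "C_log_limit_star _ =
     (INF A\<in>{A :: real \<Rightarrow> real \<Rightarrow> 'w algorithm. \<forall>R\<ge>1. \<forall>D\<ge>1. online_algorithm R D (A R D)}.
        C_log_limit A)"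

end

theory Submission
  imports Defs
begin

text \<open>Upper bound. Price the capacity of server \<open>i\<close> at time \<open>\<tau>\<close> by \<open>\<Psi>\<close> of its projected availability. As FLB
  maximizes the reduced reward, the offline reward is at most FLB's reward plus the prices that the
  offline jobs see at their inspection times. For a fixed job the projected load decreases in \<open>\<tau>\<close>, so
  dropping its last inspection loses only a factor \<open>\<gamma> / (\<gamma> - 1)\<close>; the remaining offline inspections
  number at most \<open>c\<^sub>i\<close> in any window of length \<open>1 / \<gamma>\<close>. Every price telescopes over the FLB jobs that
  cause it, and the job \<open>k\<close> contributes \<open>(\<beta>\<^bsup>1/c\<^esup> - 1) (\<Psi> + \<eta>)\<close>, where \<open>\<Psi>\<close> is the price seen by \<open>k\<close>
  itself. Exchanging the sums, job \<open>k\<close> is charged about \<open>ln \<beta>\<close> times the prices it paid, which are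
  below its reward. Capacities are respected as soon as \<open>\<eta> (\<beta> - 1) \<ge> R D\<close>; taking \<open>\<gamma>\<close> of order
  \<open>ln (R D)\<close> and \<open>\<eta> = 1 / \<gamma>\<^sup>2\<close> makes \<open>ln \<beta> = ln (R D) + 2 ln ln (R D) + O(1)\<close>.

  Lower bound. At time \<open>0\<close>, batches of \<open>c\<close> jobs arrive whose total rewards grow geometrically from \<open>1\<close>
  to \<open>R D\<close>, and the sequence may stop after any batch.\<close>

section \<open>Prices and inspections\<close>

text \<open>The index \<open>n\<close> is independent of any particular job, so that prices can be
  built up by induction over arrivals.\<close>

definition load :: "problem \<Rightarrow> (nat \<Rightarrow> nat option) \<Rightarrow> nat \<Rightarrow> nat \<Rightarrow> real \<Rightarrow> nat" where
  "load I a i n \<tau> = card {k. k < n \<and> a k = Some i \<and> time I k + dur I i k > \<tau>}"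

definition price :: "real \<Rightarrow> real \<Rightarrow> problem \<Rightarrow> (nat \<Rightarrow> nat option) \<Rightarrow> nat \<Rightarrow> nat \<Rightarrow> real \<Rightarrow> real" where
  "price \<eta> \<beta> I a i n \<tau> = Psi \<eta> \<beta> (proj_capacity I a i n \<tau>)"

definition inspections :: "real \<Rightarrow> problem \<Rightarrow> nat \<Rightarrow> nat \<Rightarrow> nat" where
  "inspections \<gamma> I i j = nat \<lceil>\<gamma> * dur I i j\<rceil>"

lemma price_eq: "price \<eta> \<beta> I a i n \<tau> = \<eta> * (\<beta> powr (real (load I a i n \<tau>) / real (cap I i)) - 1)"
  by (simp add: price_def Psi_def proj_capacity_def load_def)

lemma load_antimono: "\<tau> \<le> \<tau>' \<Longrightarrow> load I a i n \<tau>' \<le> load I a i n \<tau>"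
  unfolding load_def by (rule card_mono) auto

lemma price_nonneg:
  assumes "\<eta> \<ge> 0" "\<beta> \<ge> 1"
  shows "price \<eta> \<beta> I a i n \<tau> \<ge> 0"
  using assms by (simp add: price_eq ge_one_powr_ge_zero)

lemma price_antimono:
  assumes "\<eta> \<ge> 0" "\<beta> \<ge> 1" "\<tau> \<le> \<tau>'"
  shows "price \<eta> \<beta> I a i n \<tau>' \<le> price \<eta> \<beta> I a i n \<tau>"
  unfolding price_eq using assms load_antimono[OF assms(3), of I a i n]
  by (intro mult_left_mono diff_right_mono powr_mono divide_right_mono) auto

lemma load_Suc:
  "load I a i (Suc n) \<tau> = load I a i n \<tau> + of_bool (a n = Some i \<and> time I n + dur I i n > \<tau>)"
proof -
  have "{k. k < Suc n \<and> a k = Some i \<and> time I k + dur I i k > \<tau>} =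
    (if a n = Some i \<and> time I n + dur I i n > \<tau> then {n} else {}) \<union>
    {k. k < n \<and> a k = Some i \<and> time I k + dur I i k > \<tau>}"
    by (auto simp: less_Suc_eq)
  then show ?thesis by (simp add: load_def)
qed

text \<open>Each job accepted by \<open>i\<close> and still running at \<open>\<tau>\<close>
  multiplies \<open>price + \<eta>\<close> by \<open>\<beta> powr (1 / c)\<close>. The price starts
  at 0, so it is the sum of these increments, each a fixed multiple of \<open>price + \<eta>\<close>
  as seen by the job that causes it.\<close>

lemma price_telescope:
  assumes "\<beta> > 0"
  shows "price \<eta> \<beta> I a i n \<tau> = (\<beta> powr (1 / real (cap I i)) - 1) *
    (\<Sum>k | k < n \<and> a k = Some i \<and> time I k + dur I i k > \<tau>. price \<eta> \<beta> I a i k \<tau> + \<eta>)"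
proof (induction n)
  case 0
  show ?case using assms by (simp add: price_eq load_def)
next
  case (Suc n)
  let ?B = "a n = Some i \<and> time I n + dur I i n > \<tau>"
  have set: "{k. k < Suc n \<and> a k = Some i \<and> time I k + dur I i k > \<tau>} =
    (if ?B then insert n {k. k < n \<and> a k = Some i \<and> time I k + dur I i k > \<tau>}
     else {k. k < n \<and> a k = Some i \<and> time I k + dur I i k > \<tau>})"
    by (auto simp: less_Suc_eq)
  have step: "price \<eta> \<beta> I a i (Suc n) \<tau> = price \<eta> \<beta> I a i n \<tau> +
     (if ?B then (\<beta> powr (1 / real (cap I i)) - 1) * (price \<eta> \<beta> I a i n \<tau> + \<eta>) else 0)"
    by (auto simp: price_eq load_Suc add_divide_distrib powr_add algebra_simps)
  show ?case
    unfolding step set by (auto simp: Suc.IH algebra_simps)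
qed

section \<open>Inspection times as a grid of mesh \<open>1 / \<gamma>\<close>\<close>

lemma less_inspections_iff:
  assumes "\<gamma> > 0"
  shows "l < inspections \<gamma> I i j \<longleftrightarrow> real l / \<gamma> < dur I i j"
proof -
  have "real l / \<gamma> < dur I i j \<longleftrightarrow> real l < \<gamma> * dur I i j"
    using assms by (simp add: field_simps)
  then show ?thesis unfolding inspections_def by linarith
qed

lemma inspection_times_eq:
  assumes "\<gamma> > 0"
  shows "inspection_times \<gamma> I i j = (\<lambda>l. time I j + real l / \<gamma>) ` {..<inspections \<gamma> I i j}"
  using assms by (auto simp: inspection_times_def less_inspections_iff)

lemma reduced_reward_eq:
  assumes "\<gamma> > 0"
  shows "reduced_reward \<gamma> \<eta> \<beta> I a i j = rew I i j * dur I i j -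
    (\<Sum>l<inspections \<gamma> I i j. price \<eta> \<beta> I a i j (time I j + real l / \<gamma>))"
proof -
  have "inj_on (\<lambda>l. time I j + real l / \<gamma>) {..<inspections \<gamma> I i j}"
    using assms by (auto simp: inj_on_def)
  then show ?thesis
    by (simp add: reduced_reward_def inspection_times_eq[OF assms] sum.reindex price_def)
qed

text \<open>The last term is the smallest, hence at most the average of the other
  \<open>L - 1 \<ge> \<gamma> - 1\<close> terms; including it costs a factor of at most
  \<open>1 + 1 / (\<gamma> - 1)\<close>.\<close>

lemma sum_le_sum_butlast:
  fixes g :: "nat \<Rightarrow> real"
  assumes anti: "\<And>l l'. l \<le> l' \<Longrightarrow> g l' \<le> g l" and nonneg: "\<And>l. g l \<ge> 0"
    and L: "real L \<ge> \<gamma>" and "\<gamma> > 1"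
  shows "(\<Sum>l<L. g l) \<le> \<gamma> / (\<gamma> - 1) * (\<Sum>l<L - 1. g l)"
proof -
  obtain M where M: "L = Suc M" using L \<open>\<gamma> > 1\<close> by (cases L) auto
  have "real M * g M = (\<Sum>l<M. g M)" by simp
  also have "\<dots> \<le> (\<Sum>l<M. g l)" by (intro sum_mono anti) auto
  finally have 1: "real M * g M \<le> (\<Sum>l<M. g l)" .
  have "(\<gamma> - 1) * g M \<le> real M * g M"
    using L M nonneg by (intro mult_right_mono) auto
  with 1 have "(\<gamma> - 1) * ((\<Sum>l<M. g l) + g M) \<le> \<gamma> * (\<Sum>l<M. g l)"
    by (simp add: algebra_simps)
  then show ?thesis using \<open>\<gamma> > 1\<close> M by (simp add: field_simps)
qed

text \<open>A job whose inspection in the slot \<open>[s, s + 1/\<gamma>)\<close> is not its last one is still running at time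
  \<open>s + 1/\<gamma>\<close>, so feasibility allows at most \<open>c\<^sub>i\<close> such inspections per slot.\<close>

lemma sum_butlast_inspections_le:
  fixes f :: "real \<Rightarrow> real" and s :: real and n :: nat
  assumes "\<gamma> > 0" and feas: "feasible I b" and i: "i < num_servers I"
    and anti: "\<And>\<tau> \<tau>'. \<tau> \<le> \<tau>' \<Longrightarrow> f \<tau>' \<le> f \<tau>" and nonneg: "\<And>\<tau>. f \<tau> \<ge> 0"
  defines "Q \<equiv> {(j, l). j < num_jobs I \<and> b j = Some i \<and> l < inspections \<gamma> I i j - 1 \<and>
     s \<le> time I j + real l / \<gamma> \<and> time I j + real l / \<gamma> < s + real n / \<gamma>}"
  shows "(\<Sum>(j, l)\<in>Q. f (time I j + real l / \<gamma>)) \<le>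
     real (cap I i) * (\<Sum>m<n. f (s + real m / \<gamma>))"
proof -
  define slot where "slot = (\<lambda>(j, l). nat \<lfloor>\<gamma> * (time I j + real l / \<gamma> - s)\<rfloor>)"
  have "Q \<subseteq> Sigma {..<num_jobs I} (\<lambda>j. {..<inspections \<gamma> I i j})"
    by (auto simp: Q_def)
  then have finQ: "finite Q" by (rule finite_subset) auto
  have slot_bounds: "real (slot (j, l)) \<le> \<gamma> * (time I j + real l / \<gamma> - s)"
      "\<gamma> * (time I j + real l / \<gamma> - s) < real (slot (j, l)) + 1" if "(j, l) \<in> Q" for j l
  proof -
    have "0 \<le> \<gamma> * (time I j + real l / \<gamma> - s)"
      using that \<open>\<gamma> > 0\<close> by (simp add: Q_def)
    then show "real (slot (j, l)) \<le> \<gamma> * (time I j + real l / \<gamma> - s)"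
      "\<gamma> * (time I j + real l / \<gamma> - s) < real (slot (j, l)) + 1"
      unfolding slot_def prod.case by linarith+
  qed
  have slot_times: "s + real (slot (j, l)) / \<gamma> \<le> time I j + real l / \<gamma>"
      "time I j + real l / \<gamma> < s + (real (slot (j, l)) + 1) / \<gamma>" if "(j, l) \<in> Q" for j l
    using slot_bounds[OF that] \<open>\<gamma> > 0\<close> by (simp_all add: field_simps)
  have slot_range: "slot ` Q \<subseteq> {..<n}"
  proof clarify
    fix j l assume q: "(j, l) \<in> Q"
    then have "time I j + real l / \<gamma> < s + real n / \<gamma>" by (simp add: Q_def)
    with slot_times(1)[OF q] have "real (slot (j, l)) / \<gamma> < real n / \<gamma>" by linarith
    then show "slot (j, l) < n" using \<open>\<gamma> > 0\<close> by (simp add: divide_less_cancel)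
  qed
  have fiber: "card {x \<in> Q. slot x = m} \<le> cap I i" for m
  proof -
    let ?F = "{x \<in> Q. slot x = m}"
    \<comment> \<open>The right end of slot \<open>m\<close>: every job of the fiber has arrived by
      then, and its next grid point, still within its duration, is not earlier.\<close>
    let ?t = "s + (real m + 1) / \<gamma>"
    \<comment> \<open>Grid points of one job are \<open>1 / \<gamma>\<close> apart, so no job
      inspects a slot twice and the fiber may be counted by jobs.\<close>
    have inj: "inj_on fst ?F"
    proof (rule inj_onI)
      fix x y assume x: "x \<in> ?F" and y: "y \<in> ?F" and "fst x = fst y"
      then obtain j l l' where xy: "x = (j, l)" "y = (j, l')" by (cases x, cases y) auto
      have "real l < real l' + 1" "real l' < real l + 1"
        using slot_bounds[of j l] slot_bounds[of j l'] x y xy \<open>\<gamma> > 0\<close>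
        by (auto simp: algebra_simps)
      then show "x = y" using xy by auto
    qed
    have "fst ` ?F \<subseteq> {j \<in> active I i ?t. b j = Some i}"
    proof clarify
      fix j l assume q: "(j, l) \<in> Q" and sl: "m = slot (j, l)"
      have j: "j < num_jobs I" "b j = Some i" "Suc l < inspections \<gamma> I i j"
        using q by (auto simp: Q_def)
      then have "i \<in> nbrs I j" using feas by (auto simp: feasible_def)
      moreover have "time I j \<le> ?t"
      proof -
        have "0 \<le> real l / \<gamma>" using \<open>\<gamma> > 0\<close> by simp
        then show ?thesis using slot_times(2)[OF q] sl by simp
      qed
      moreover have "?t < time I j + dur I i j"
      proof -
        have "real (Suc l) / \<gamma> < dur I i j" using j less_inspections_iff[OF \<open>\<gamma> > 0\<close>] by blast
        moreover have "?t \<le> time I j + real (Suc l) / \<gamma>"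
          using slot_times(1)[OF q] sl by (simp add: add_divide_distrib)
        ultimately show ?thesis by linarith
      qed
      ultimately show "fst (j, l) \<in> active I i (s + (real (slot (j, l)) + 1) / \<gamma>) \<and>
          b (fst (j, l)) = Some i"
        using j sl by (simp add: active_def)
    qed
    moreover have "finite {j \<in> active I i ?t. b j = Some i}" by (simp add: active_def)
    ultimately have "card (fst ` ?F) \<le> card {j \<in> active I i ?t. b j = Some i}"
      by (rule card_mono[rotated])
    also have "\<dots> \<le> cap I i" using feas i by (simp add: feasible_def)
    finally show ?thesis using card_image[OF inj] by simp
  qed
  have "(\<Sum>(j, l)\<in>Q. f (time I j + real l / \<gamma>)) \<le> (\<Sum>x\<in>Q. f (s + real (slot x) / \<gamma>))"
    using slot_times(1) by (intro sum_mono) (auto intro!: anti)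
  also have "\<dots> = (\<Sum>m<n. \<Sum>x\<in>{x \<in> Q. slot x = m}. f (s + real (slot x) / \<gamma>))"
    by (rule sum.group[symmetric]) (use finQ slot_range in auto)
  also have "\<dots> = (\<Sum>m<n. real (card {x \<in> Q. slot x = m}) * f (s + real m / \<gamma>))"
    by (intro sum.cong) auto
  also have "\<dots> \<le> (\<Sum>m<n. real (cap I i) * f (s + real m / \<gamma>))"
    using fiber nonneg by (intro sum_mono mult_right_mono) auto
  finally show ?thesis by (simp add: sum_distrib_left)
qed

text \<open>The price seen by a job of \<open>b\<close> is charged to the jobs of \<open>a\<close>
  that caused it. A job \<open>k\<close> is charged only through inspections during its own
  occupancy, and slot counting bounds these by \<open>cap I i\<close> times the values at its own
  inspection times.\<close>

lemma server_price_bound: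
  assumes "\<gamma> > 1" "\<eta> \<ge> 0" "\<beta> \<ge> 1" and valid: "valid_problem I"
    and feas: "feasible I b" and i: "i < num_servers I"
  shows "(\<Sum>j | j < num_jobs I \<and> b j = Some i. \<Sum>l<inspections \<gamma> I i j.
            price \<eta> \<beta> I a i j (time I j + real l / \<gamma>)) \<le>
     \<gamma> / (\<gamma> - 1) * (real (cap I i) * (\<beta> powr (1 / real (cap I i)) - 1)) *
     (\<Sum>k | k < num_jobs I \<and> a k = Some i. \<Sum>l<inspections \<gamma> I i k.
            price \<eta> \<beta> I a i k (time I k + real l / \<gamma>) + \<eta>)"
proof -
  define \<delta> where "\<delta> = \<beta> powr (1 / real (cap I i)) - 1"
  have "\<delta> \<ge> 0" using assms by (simp add: \<delta>_def ge_one_powr_ge_zero)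
  let ?O = "{j. j < num_jobs I \<and> b j = Some i}"
  let ?A = "{k. k < num_jobs I \<and> a k = Some i}"
  let ?\<tau> = "\<lambda>j l. time I j + real l / \<gamma>"
  let ?P = "price \<eta> \<beta> I a i"
  define S where "S = Sigma ?O (\<lambda>j. {..<inspections \<gamma> I i j - 1})"
  have finS: "finite S" by (simp add: S_def)
  have L: "real (inspections \<gamma> I i j) \<ge> \<gamma>" if "j \<in> ?O" for j
  proof -
    have "i \<in> nbrs I j" using that feas by (auto simp: feasible_def)
    then have "dur I i j \<ge> 1" using that valid by (auto simp: valid_problem_def)
    then have "\<gamma> * 1 \<le> \<gamma> * dur I i j" using \<open>\<gamma> > 1\<close> by (intro mult_left_mono) auto
    then show ?thesis unfolding inspections_def by linarith
  qed
  have 1: "(\<Sum>l<inspections \<gamma> I i j. ?P j (?\<tau> j l)) \<le>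
      \<gamma> / (\<gamma> - 1) * (\<Sum>l<inspections \<gamma> I i j - 1. ?P j (?\<tau> j l))" if "j \<in> ?O" for j
    using assms L[OF that]
    by (intro sum_le_sum_butlast price_antimono price_nonneg) (auto intro: divide_right_mono)
  \<comment> \<open>An inspection by a later job of \<open>b\<close> that still sees
    \<open>k\<close> falls between the arrival and the departure of \<open>k\<close>. Rounding the
    departure up to whole slots gives as many slots as \<open>k\<close> has inspections.\<close>
  have window: "(\<Sum>(j, l) | (j, l) \<in> S \<and> k < j \<and> ?\<tau> j l < time I k + dur I i k. ?P k (?\<tau> j l) + \<eta>)
      \<le> real (cap I i) * (\<Sum>l<inspections \<gamma> I i k. ?P k (?\<tau> k l) + \<eta>)" for k
  proof -
    let ?Q = "{(j, l). j < num_jobs I \<and> b j = Some i \<and> l < inspections \<gamma> I i j - 1 \<and>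
     time I k \<le> ?\<tau> j l \<and> ?\<tau> j l < time I k + real (inspections \<gamma> I i k) / \<gamma>}"
    have "dur I i k \<le> real (inspections \<gamma> I i k) / \<gamma>"
      using less_inspections_iff[of \<gamma> "inspections \<gamma> I i k" I i k] \<open>\<gamma> > 1\<close> by auto
    moreover have "time I k \<le> time I j + real l / \<gamma>" if "j < num_jobs I" "k < j" for j l
      using valid that \<open>\<gamma> > 1\<close> by (auto simp: valid_problem_def intro!: add_increasing2)
    ultimately have sub: "{(j, l). (j, l) \<in> S \<and> k < j \<and> ?\<tau> j l < time I k + dur I i k} \<subseteq> ?Q"
      by (force simp: S_def)
    have "?Q \<subseteq> S" by (auto simp: S_def)
    then have fin: "finite ?Q" using finS by (rule finite_subset)
    have "(\<Sum>(j, l) | (j, l) \<in> S \<and> k < j \<and> ?\<tau> j l < time I k + dur I i k. ?P k (?\<tau> j l) + \<eta>)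
      \<le> (\<Sum>(j, l)\<in>?Q. ?P k (?\<tau> j l) + \<eta>)"
      using assms by (intro sum_mono2 fin sub) (auto intro!: add_nonneg_nonneg price_nonneg)
    also have "\<dots> \<le> real (cap I i) * (\<Sum>l<inspections \<gamma> I i k. ?P k (?\<tau> k l) + \<eta>)"
      using assms by (intro sum_butlast_inspections_le[where f = "\<lambda>\<tau>. ?P k \<tau> + \<eta>"])
        (auto intro!: add_nonneg_nonneg price_nonneg price_antimono)
    finally show ?thesis .
  qed
  have "(\<Sum>j\<in>?O. \<Sum>l<inspections \<gamma> I i j. ?P j (?\<tau> j l)) \<le>
      (\<Sum>j\<in>?O. \<gamma> / (\<gamma> - 1) * (\<Sum>l<inspections \<gamma> I i j - 1. ?P j (?\<tau> j l)))"
    by (rule sum_mono) (rule 1)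
  also have "\<dots> = \<gamma> / (\<gamma> - 1) * (\<Sum>(j, l)\<in>S. ?P j (?\<tau> j l))"
    unfolding sum_distrib_left[symmetric] S_def by (subst sum.Sigma) auto
  \<comment> \<open>Expand each price into the increments that produced it; exchanging the sums then
    collects, for each \<open>k\<close>, all inspections that see it.\<close>
  also have "(\<Sum>(j, l)\<in>S. ?P j (?\<tau> j l)) = (\<Sum>(j, l)\<in>S. \<delta> *
      (\<Sum>k | k < j \<and> a k = Some i \<and> time I k + dur I i k > ?\<tau> j l. ?P k (?\<tau> j l) + \<eta>))"
    unfolding \<delta>_def using \<open>\<beta> \<ge> 1\<close> by (subst price_telescope) auto
  also have "\<dots> = \<delta> * (\<Sum>x\<in>S. \<Sum>k | k \<in> ?A \<and> (k < fst x \<and>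
      ?\<tau> (fst x) (snd x) < time I k + dur I i k). ?P k (?\<tau> (fst x) (snd x)) + \<eta>)"
    unfolding sum_distrib_left
    by (intro sum.cong) (auto simp: S_def split: prod.splits intro!: sum.cong)
  also have "(\<Sum>x\<in>S. \<Sum>k | k \<in> ?A \<and> (k < fst x \<and>
      ?\<tau> (fst x) (snd x) < time I k + dur I i k). ?P k (?\<tau> (fst x) (snd x)) + \<eta>) =
      (\<Sum>k\<in>?A. \<Sum>x | x \<in> S \<and> (k < fst x \<and> ?\<tau> (fst x) (snd x) < time I k + dur I i k).
         ?P k (?\<tau> (fst x) (snd x)) + \<eta>)"
    by (rule sum.swap_restrict) (use finS in auto)
  also have "\<dots> = (\<Sum>k\<in>?A. \<Sum>(j, l) | (j, l) \<in> S \<and> k < j \<and> ?\<tau> j l < time I k + dur I i k.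
      ?P k (?\<tau> j l) + \<eta>)"
    by (intro sum.cong) auto
  also have "\<gamma> / (\<gamma> - 1) * (\<delta> * \<dots>) \<le> \<gamma> / (\<gamma> - 1) * (\<delta> *
      (\<Sum>k\<in>?A. real (cap I i) * (\<Sum>l<inspections \<gamma> I i k. ?P k (?\<tau> k l) + \<eta>)))"
    using \<open>\<delta> \<ge> 0\<close> \<open>\<gamma> > 1\<close> window by (intro mult_left_mono sum_mono) auto
  also have "\<dots> = \<gamma> / (\<gamma> - 1) * (real (cap I i) * \<delta>) *
     (\<Sum>k\<in>?A. \<Sum>l<inspections \<gamma> I i k. ?P k (?\<tau> k l) + \<eta>)"
    by (simp add: sum_distrib_left[symmetric] mult_ac)
  finally show ?thesis unfolding \<delta>_def .
qed

section \<open>Feasibility and competitiveness of FLB\<close>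

lemma total_reward_by_server:
  assumes "\<And>j i. j < num_jobs I \<Longrightarrow> a j = Some i \<Longrightarrow> i < num_servers I"
  shows "total_reward I a =
    (\<Sum>i<num_servers I. \<Sum>j | j < num_jobs I \<and> a j = Some i. rew I i j * dur I i j)"
proof -
  have "(case a j of None \<Rightarrow> 0 | Some i \<Rightarrow> rew I i j * dur I i j) =
      (\<Sum>i | i < num_servers I \<and> a j = Some i. rew I i j * dur I i j)" if "j < num_jobs I" for j
  proof (cases "a j")
    case (Some i)
    then have "{i. i < num_servers I \<and> a j = Some i} = {i}" using assms[OF that] by auto
    then show ?thesis using Some by simp
  qed simp
  then have "total_reward I a =
      (\<Sum>j<num_jobs I. \<Sum>i | i \<in> {..<num_servers I} \<and> a j = Some i. rew I i j * dur I i j)"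
    unfolding total_reward_def by (intro sum.cong) auto
  also have "\<dots> = (\<Sum>i<num_servers I. \<Sum>j | j \<in> {..<num_jobs I} \<and> a j = Some i.
      rew I i j * dur I i j)"
    by (rule sum.swap_restrict) auto
  finally show ?thesis by simp
qed

lemma nbrs_less_num_servers:
  "valid_problem I \<Longrightarrow> j < num_jobs I \<Longrightarrow> i \<in> nbrs I j \<Longrightarrow> i < num_servers I"
  by (auto simp: valid_problem_def)

lemma finite_nbrs: "valid_problem I \<Longrightarrow> j < num_jobs I \<Longrightarrow> finite (nbrs I j)"
  using nbrs_less_num_servers[of I j] by (intro finite_subset[of "nbrs I j" "{..<num_servers I}"]) auto

lemma flb_decision_SomeD:
  assumes "flb_decision \<gamma> \<eta> \<beta> I a j" "a j = Some i"
  shows "i \<in> nbrs I j" "reduced_reward \<gamma> \<eta> \<beta> I a i j > 0"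
  using assms by (auto simp: flb_decision_def split: if_splits intro: less_le_trans)

lemma reduced_reward_le_flb:
  assumes "flb_decision \<gamma> \<eta> \<beta> I a j" "i \<in> nbrs I j"
  shows "reduced_reward \<gamma> \<eta> \<beta> I a i j \<le>
    (case a j of None \<Rightarrow> 0 | Some k \<Rightarrow> reduced_reward \<gamma> \<eta> \<beta> I a k j)"
  using assms by (auto simp: flb_decision_def not_less split: if_splits)

text \<open>On arrival of a job a full server has price at least
  \<open>\<eta> * (\<beta> - 1) \<ge> R * D\<close>, which no reward exceeds, so FLB never selects
  it.\<close>

lemma feasible_flb:
  assumes "\<gamma> > 0" "\<eta> > 0" "\<beta> > 1" and P: "I \<in> problems R D" and "R \<ge> 1"
    and penalty: "R * D \<le> \<eta> * (\<beta> - 1)"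
    and flb: "\<And>j. j < num_jobs I \<Longrightarrow> flb_decision \<gamma> \<eta> \<beta> I a j"
  shows "feasible I a"
  unfolding feasible_def
proof (intro conjI allI impI)
  show "i \<in> nbrs I j" if "j < num_jobs I" "a j = Some i" for i j
    using flb_decision_SomeD flb that by blast
next
  fix i t assume i: "i < num_servers I"
  let ?S = "{j \<in> active I i t. a j = Some i}"
  have valid: "valid_problem I" using P by (simp add: problems_def)
  have fin: "finite ?S" by (simp add: active_def)
  show "card ?S \<le> cap I i"
  proof (cases "?S = {}")
    case False
    \<comment> \<open>Among the jobs present at \<open>t\<close>, take the last one. The others were
      assigned before it and run beyond \<open>t\<close>, so they all count in its projected load at
      its arrival.\<close>
    define j where "j = Max ?S"
    have j: "j \<in> ?S" "\<And>k. k \<in> ?S \<Longrightarrow> k \<le> j"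
      unfolding j_def using Max_in[OF fin False] Max_ge[OF fin] by blast+
    then have jm: "j < num_jobs I" and aj: "a j = Some i" and tj: "time I j \<le> t"
      by (auto simp: active_def)
    note dec = flb_decision_SomeD[OF flb[OF jm] aj]
    let ?U = "{k. k < j \<and> a k = Some i \<and> time I k + dur I i k > time I j}"
    have dur: "1 \<le> dur I i j" "dur I i j \<le> D" "rew I i j \<le> R"
      using valid P jm dec(1) by (auto simp: valid_problem_def problems_def)
    have "0 < inspections \<gamma> I i j"
      using \<open>\<gamma> > 0\<close> dur(1) by (simp add: less_inspections_iff)
    \<comment> \<open>The inspection \<open>l = 0\<close> takes place at the arrival itself; as
      prices are nonnegative, it alone bounds the current load.\<close>
    then have "price \<eta> \<beta> I a i j (time I j + real 0 / \<gamma>) \<le>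
        (\<Sum>l<inspections \<gamma> I i j. price \<eta> \<beta> I a i j (time I j + real l / \<gamma>))"
      using assms(2,3) by (intro member_le_sum price_nonneg) auto
    also have "\<dots> < rew I i j * dur I i j"
      using dec(2) by (simp add: reduced_reward_eq[OF \<open>\<gamma> > 0\<close>])
    also have "\<dots> \<le> R * D" using dur \<open>R \<ge> 1\<close> by (intro mult_mono) auto
    also have "\<dots> \<le> \<eta> * (\<beta> - 1)" by (rule penalty)
    finally have "\<beta> powr (real (load I a i j (time I j)) / real (cap I i)) < \<beta>"
      using \<open>\<eta> > 0\<close> by (simp add: price_eq)
    then have "\<beta> powr (real (load I a i j (time I j)) / real (cap I i)) < \<beta> powr 1"
      using \<open>\<beta> > 1\<close> by simp
    then have "real (load I a i j (time I j)) / real (cap I i) < 1"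
      using \<open>\<beta> > 1\<close> by (simp only: powr_less_cancel_iff)
    moreover have "cap I i \<ge> 1" using valid i by (simp add: valid_problem_def)
    ultimately have "card ?U < cap I i" by (simp add: load_def field_simps)
    moreover have "?S \<subseteq> insert j ?U"
    proof
      fix k assume k: "k \<in> ?S"
      then have "time I k + dur I i k > time I j" using tj by (auto simp: active_def)
      then show "k \<in> insert j ?U" using k j(2)[OF k] by auto
    qed
    then have "card ?S \<le> card (insert j ?U)" by (intro card_mono) auto
    moreover have "card (insert j ?U) \<le> Suc (card ?U)" by (rule card_insert_le_m1) auto
    ultimately show ?thesis by linarith
  next
    case True
    then show ?thesis by (simp only: card.empty)
  qed
qed

section \<open>Primal-dual comparison with offline assignments\<close>

lemma c_min_le: "i < num_servers I \<Longrightarrow> c_min I \<le> cap I i"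
  unfolding c_min_def by (intro Min_le) auto

lemma c_min_pos:
  assumes "valid_problem I"
  shows "c_min I \<ge> 1"
proof -
  have "c_min I \<in> cap I ` {..<num_servers I}"
    unfolding c_min_def using assms by (intro Min_in) (auto simp: valid_problem_def lessThan_empty_iff)
  then show ?thesis using assms by (auto simp: valid_problem_def)
qed

lemma exp_minus_one_le: "exp x - 1 \<le> x * exp x" for x :: real
proof -
  have "exp x * (1 - x) \<le> exp x * exp (- x)"
    using exp_ge_add_one_self[of "- x"] by (intro mult_left_mono) auto
  then show ?thesis by (simp add: algebra_simps flip: exp_add)
qed

text \<open>The left side tends to \<open>ln \<beta>\<close> as \<open>c'\<close> grows. Its excess
  is controlled by \<open>exp x - 1 \<le> x * exp x\<close> at \<open>x = ln \<beta> / c'\<close>,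
  and one factor \<open>\<beta> powr (1 / c)\<close> serves all capacities from \<open>c\<close>
  on.\<close>

lemma capacity_increment_le:
  assumes "\<beta> \<ge> 1" "1 \<le> c" "c \<le> c'"
  shows "real c' * (\<beta> powr (1 / real c') - 1) \<le> ln \<beta> * \<beta> powr (1 / real c)"
proof -
  have "\<beta> powr (1 / real c') - 1 \<le> (ln \<beta> / real c') * \<beta> powr (1 / real c')"
    using exp_minus_one_le[of "ln \<beta> / real c'"] assms by (simp add: powr_def)
  then have "real c' * (\<beta> powr (1 / real c') - 1) \<le>
      real c' * ((ln \<beta> / real c') * \<beta> powr (1 / real c'))"
    by (intro mult_left_mono) auto
  also have "\<dots> = ln \<beta> * \<beta> powr (1 / real c')" using assms by simp
  also have "\<dots> \<le> ln \<beta> * \<beta> powr (1 / real c)"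
    using assms by (intro mult_left_mono powr_mono) (auto simp: field_simps)
  finally show ?thesis .
qed

text \<open>Each offline assignment is covered by \<open>gain j\<close>, the dual variable of the
  job, plus the prices along its inspections. Gains sum to at most the reward of FLB, and prices are
  charged to FLB's jobs by \<open>server_price_bound\<close>. The last factor pays for the surcharge
  \<open>\<eta>\<close> per inspection.\<close>

lemma flb_competitive:
  assumes "\<gamma> > 1" "\<eta> \<ge> 0" "\<beta> \<ge> 1" and valid: "valid_problem I"
    and flb: "\<And>j. j < num_jobs I \<Longrightarrow> flb_decision \<gamma> \<eta> \<beta> I a j" and feas: "feasible I b"
  shows "total_reward I b \<le>
    (1 + \<gamma> / (\<gamma> - 1) * (ln \<beta> * \<beta> powr (1 / real (c_min I))) * (1 + \<eta> * (\<gamma> + 1))) * total_reward I a"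
proof -
  let ?O = "\<lambda>i. {j. j < num_jobs I \<and> b j = Some i}"
  let ?A = "\<lambda>i. {j. j < num_jobs I \<and> a j = Some i}"
  let ?cost = "\<lambda>i j. \<Sum>l<inspections \<gamma> I i j. price \<eta> \<beta> I a i j (time I j + real l / \<gamma>)"
  let ?red = "reduced_reward \<gamma> \<eta> \<beta> I a"
  define B where "B = ln \<beta> * \<beta> powr (1 / real (c_min I))"
  have red: "?red i j = rew I i j * dur I i j - ?cost i j" for i j
    using \<open>\<gamma> > 1\<close> by (simp add: reduced_reward_eq)
  have cost_nonneg: "?cost i j \<ge> 0" for i j
    using assms(2,3) by (intro sum_nonneg price_nonneg)
  have bn: "i \<in> nbrs I j" if "j \<in> ?O i" for i j using that feas by (auto simp: feasible_def)
  have an: "i \<in> nbrs I j" "?red i j > 0" if "j \<in> ?A i" for i j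
    using that flb flb_decision_SomeD[of \<gamma> \<eta> \<beta> I a j i] by auto
  have reward_ge: "1 \<le> rew I i j" "1 \<le> dur I i j" if "j < num_jobs I" "i \<in> nbrs I j" for i j
    using valid that by (auto simp: valid_problem_def)
  have ALG: "total_reward I a = (\<Sum>i<num_servers I. \<Sum>j\<in>?A i. rew I i j * dur I i j)"
    by (rule total_reward_by_server) (use an(1) valid nbrs_less_num_servers in blast)
  have OPT: "total_reward I b = (\<Sum>i<num_servers I. \<Sum>j\<in>?O i. rew I i j * dur I i j)"
    by (rule total_reward_by_server) (use bn valid nbrs_less_num_servers in blast)
  \<comment> \<open>A rejected job has no positive reduced reward on any server, whence the default
    0.\<close>
  define gain where "gain j = (case a j of None \<Rightarrow> 0 | Some i \<Rightarrow> ?red i j)" for j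
  have gain_bounds: "0 \<le> gain j" "gain j \<le> (case a j of None \<Rightarrow> 0 | Some i \<Rightarrow> rew I i j * dur I i j)"
    if "j < num_jobs I" for j
    using that an(2)[of j] cost_nonneg[of _ j] by (auto simp: gain_def red split: option.splits intro: less_imp_le)
  have lam: "(\<Sum>i<num_servers I. \<Sum>j\<in>?O i. gain j) \<le> total_reward I a"
  proof -
    have "(\<Sum>i<num_servers I. \<Sum>j\<in>?O i. gain j) =
        (\<Sum>i<num_servers I. \<Sum>j | j \<in> {..<num_jobs I} \<and> b j = Some i. gain j)" by simp
    also have "\<dots> = (\<Sum>j<num_jobs I. \<Sum>i | i \<in> {..<num_servers I} \<and> b j = Some i. gain j)"
      by (rule sum.swap_restrict) auto
    also have "\<dots> \<le> (\<Sum>j<num_jobs I. case a j of None \<Rightarrow> 0 | Some i \<Rightarrow> rew I i j * dur I i j)"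
    proof (rule sum_mono)
      fix j assume "j \<in> {..<num_jobs I}"
      then have j: "j < num_jobs I" by simp
      \<comment> \<open>\<open>b j\<close> names at most one server, so each gain is counted at most
        once.\<close>
      have "{i. i \<in> {..<num_servers I} \<and> b j = Some i} \<subseteq> set_option (b j)" by auto
      then have "(\<Sum>i | i \<in> {..<num_servers I} \<and> b j = Some i. gain j) \<le> (\<Sum>i\<in>set_option (b j). gain j)"
        using gain_bounds(1)[OF j] by (intro sum_mono2) auto
      also have "\<dots> \<le> gain j" using gain_bounds(1)[OF j] by (cases "b j") auto
      also note gain_bounds(2)[OF j]
      finally show "(\<Sum>i | i \<in> {..<num_servers I} \<and> b j = Some i. gain j) \<le>
        (case a j of None \<Rightarrow> 0 | Some i \<Rightarrow> rew I i j * dur I i j)" .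
    qed
    finally show ?thesis by (simp add: total_reward_def)
  qed
  have B0: "B \<ge> 0" using assms(3) by (simp add: B_def)
  have server: "(\<Sum>j\<in>?O i. ?cost i j) \<le> \<gamma> / (\<gamma> - 1) * B * (1 + \<eta> * (\<gamma> + 1)) *
      (\<Sum>j\<in>?A i. rew I i j * dur I i j)" if i: "i < num_servers I" for i
  proof -
    \<comment> \<open>The prices paid by an accepted job stay below its reward. It has at most
      \<open>\<gamma> * d + 1 \<le> (\<gamma> + 1) * d\<close> inspections, and
      \<open>d \<le> r * d\<close>, so its surcharges are at most
      \<open>\<eta> * (\<gamma> + 1)\<close> times its reward.\<close>
    have job: "(\<Sum>l<inspections \<gamma> I i k. price \<eta> \<beta> I a i k (time I k + real l / \<gamma>) + \<eta>) \<le>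
        (1 + \<eta> * (\<gamma> + 1)) * (rew I i k * dur I i k)" if k: "k \<in> ?A i" for k
    proof -
      have r: "1 \<le> rew I i k" "1 \<le> dur I i k" using reward_ge k an(1)[OF k] by auto
      have rd: "dur I i k \<le> rew I i k * dur I i k"
        using mult_right_mono[OF r(1), of "dur I i k"] r by simp
      have "0 \<le> \<gamma> * dur I i k" using r \<open>\<gamma> > 1\<close> by simp
      then have "real (inspections \<gamma> I i k) \<le> \<gamma> * dur I i k + 1"
        unfolding inspections_def by linarith
      also have "\<dots> \<le> (\<gamma> + 1) * dur I i k" using r by (simp add: algebra_simps)
      also have "\<dots> \<le> (\<gamma> + 1) * (rew I i k * dur I i k)"
        using rd \<open>\<gamma> > 1\<close> by (intro mult_left_mono) auto
      finally have "\<eta> * real (inspections \<gamma> I i k) \<le> \<eta> * ((\<gamma> + 1) * (rew I i k * dur I i k))"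
        using \<open>\<eta> \<ge> 0\<close> by (rule mult_left_mono)
      moreover have "?cost i k \<le> rew I i k * dur I i k" using an(2)[OF k] by (simp add: red)
      ultimately show ?thesis by (simp add: sum.distrib algebra_simps)
    qed
    have "(\<Sum>j\<in>?O i. ?cost i j) \<le>
      \<gamma> / (\<gamma> - 1) * (real (cap I i) * (\<beta> powr (1 / real (cap I i)) - 1)) *
      (\<Sum>k\<in>?A i. \<Sum>l<inspections \<gamma> I i k. price \<eta> \<beta> I a i k (time I k + real l / \<gamma>) + \<eta>)"
      using assms i by (intro server_price_bound)
    also have "\<dots> \<le> \<gamma> / (\<gamma> - 1) * B * (\<Sum>k\<in>?A i. (1 + \<eta> * (\<gamma> + 1)) * (rew I i k * dur I i k))"
    proof (intro mult_mono mult_left_mono sum_mono job)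
      show "real (cap I i) * (\<beta> powr (1 / real (cap I i)) - 1) \<le> B"
        unfolding B_def using assms c_min_pos c_min_le i by (intro capacity_increment_le) auto
    qed (use B0 assms in \<open>auto intro!: sum_nonneg add_nonneg_nonneg price_nonneg mult_nonneg_nonneg ge_one_powr_ge_zero\<close>)
    finally show ?thesis by (simp add: sum_distrib_left mult_ac)
  qed
  have "total_reward I b \<le> (\<Sum>i<num_servers I. \<Sum>j\<in>?O i. gain j + ?cost i j)"
    unfolding OPT
  proof (intro sum_mono)
    fix i j assume "j \<in> ?O i"
    \<comment> \<open>The offline server \<open>i\<close> was among FLB's options for
      \<open>j\<close>.\<close>
    then have "?red i j \<le> gain j"
      unfolding gain_def using bn flb by (intro reduced_reward_le_flb) auto
    then show "rew I i j * dur I i j \<le> gain j + ?cost i j" by (simp add: red)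
  qed
  also have "\<dots> = (\<Sum>i<num_servers I. \<Sum>j\<in>?O i. gain j) + (\<Sum>i<num_servers I. \<Sum>j\<in>?O i. ?cost i j)"
    by (simp add: sum.distrib)
  also have "\<dots> \<le> total_reward I a + (\<Sum>i<num_servers I. \<gamma> / (\<gamma> - 1) * B * (1 + \<eta> * (\<gamma> + 1)) *
      (\<Sum>j\<in>?A i. rew I i j * dur I i j))"
    by (intro add_mono lam sum_mono server) auto
  also have "\<dots> = (1 + \<gamma> / (\<gamma> - 1) * B * (1 + \<eta> * (\<gamma> + 1))) * total_reward I a"
    unfolding sum_distrib_left[symmetric] ALG[symmetric] by (simp add: distrib_right)
  finally show ?thesis unfolding B_def .
qed

section \<open>A concrete policy in \<open>FLB\<close>\<close>

definition flb_choice ::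
  "real \<Rightarrow> real \<Rightarrow> real \<Rightarrow> problem \<Rightarrow> (nat \<Rightarrow> nat option) \<Rightarrow> nat \<Rightarrow> nat option" where
  "flb_choice \<gamma> \<eta> \<beta> I a j =
     (if \<exists>i\<in>nbrs I j. reduced_reward \<gamma> \<eta> \<beta> I a i j > 0
      then Some (SOME i. i \<in> nbrs I j \<and>
        (\<forall>k\<in>nbrs I j. reduced_reward \<gamma> \<eta> \<beta> I a k j \<le> reduced_reward \<gamma> \<eta> \<beta> I a i j))
      else None)"

text \<open>A policy receives the revealed prefix but not its past decisions, so it replays all of
  them from the empty assignment.\<close>

primrec flb_history ::
  "real \<Rightarrow> real \<Rightarrow> real \<Rightarrow> problem \<Rightarrow> nat \<Rightarrow> nat \<Rightarrow> nat option" where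
  "flb_history \<gamma> \<eta> \<beta> I 0 = (\<lambda>_. None)"
| "flb_history \<gamma> \<eta> \<beta> I (Suc n) =
     (flb_history \<gamma> \<eta> \<beta> I n)(n := flb_choice \<gamma> \<eta> \<beta> I (flb_history \<gamma> \<eta> \<beta> I n) n)"

definition flb_policy :: "real \<Rightarrow> real \<Rightarrow> real \<Rightarrow> policy" where
  "flb_policy \<gamma> \<eta> \<beta> J = flb_history \<gamma> \<eta> \<beta> J (num_jobs J) (num_jobs J - 1)"

lemma reduced_reward_cong:
  assumes "\<And>k. k < j \<Longrightarrow> a k = b k"
  shows "reduced_reward \<gamma> \<eta> \<beta> I a i j = reduced_reward \<gamma> \<eta> \<beta> I b i j"
proof -
  have "{k. k < j \<and> a k = Some i \<and> time I k + dur I i k > \<tau>} =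
      {k. k < j \<and> b k = Some i \<and> time I k + dur I i k > \<tau>}" for \<tau>
    using assms by auto
  then show ?thesis by (simp add: reduced_reward_def proj_capacity_def)
qed

lemma flb_choice_cong:
  assumes "\<And>k. k < j \<Longrightarrow> a k = b k"
  shows "flb_choice \<gamma> \<eta> \<beta> I a j = flb_choice \<gamma> \<eta> \<beta> I b j"
proof -
  have "reduced_reward \<gamma> \<eta> \<beta> I a i j = reduced_reward \<gamma> \<eta> \<beta> I b i j" for i
    using assms by (rule reduced_reward_cong)
  then show ?thesis by (simp add: flb_choice_def)
qed

lemma revealed_job:
  assumes "k \<le> m"
  shows "time (revealed I m) k = time I k" "nbrs (revealed I m) k = nbrs I k"
    "rew (revealed I m) i k = rew I i k" "dur (revealed I m) i k = dur I i k"
  using assms by (simp_all add: revealed_def time_def nbrs_def rew_def dur_def)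

lemma reduced_reward_revealed:
  assumes "j \<le> m"
  shows "reduced_reward \<gamma> \<eta> \<beta> (revealed I m) a i j = reduced_reward \<gamma> \<eta> \<beta> I a i j"
proof -
  have "{k. k < j \<and> a k = Some i \<and> time (revealed I m) k + dur (revealed I m) i k > \<tau>} =
      {k. k < j \<and> a k = Some i \<and> time I k + dur I i k > \<tau>}" for \<tau>
    using assms by (auto simp: revealed_job)
  moreover have "cap (revealed I m) i = cap I i" by (simp add: revealed_def cap_def)
  ultimately show ?thesis
    using assms by (simp add: reduced_reward_def proj_capacity_def inspection_times_def revealed_job)
qed

text \<open>The first \<open>Suc m\<close> choices read only the jobs \<open>0, ..., m\<close>, so
  replays on different prefixes reproduce the same past.\<close>

lemma flb_history_revealed:
  "n \<le> Suc m \<Longrightarrow> flb_history \<gamma> \<eta> \<beta> (revealed I m) n = flb_history \<gamma> \<eta> \<beta> I n"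
  by (induction n) (simp_all add: flb_choice_def reduced_reward_revealed revealed_job)

lemma flb_history_stable:
  "j < n \<Longrightarrow> flb_history \<gamma> \<eta> \<beta> I n j = flb_choice \<gamma> \<eta> \<beta> I (flb_history \<gamma> \<eta> \<beta> I j) j"
  by (induction n) (auto simp: less_Suc_eq)

lemma run_flb_policy:
  assumes "j < num_jobs I"
  shows "run (flb_policy \<gamma> \<eta> \<beta>) I j = flb_choice \<gamma> \<eta> \<beta> I (run (flb_policy \<gamma> \<eta> \<beta>) I) j"
proof -
  have run: "run (flb_policy \<gamma> \<eta> \<beta>) I k = flb_choice \<gamma> \<eta> \<beta> I (flb_history \<gamma> \<eta> \<beta> I k) k"
    if "k < num_jobs I" for k
  proof -
    have "num_jobs (revealed I k) = Suc k" using that by (simp add: num_jobs_def revealed_def)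
    then show ?thesis
      by (simp add: run_def flb_policy_def flb_history_revealed del: flb_history.simps)
        (simp add: flb_history_stable)
  qed
  show ?thesis
    unfolding run[OF assms]
    by (rule flb_choice_cong) (use assms in \<open>simp add: run flb_history_stable\<close>)
qed

lemma flb_policy_in_FLB: "flb_policy \<gamma> \<eta> \<beta> \<in> FLB \<gamma> \<eta> \<beta>"
  unfolding FLB_def
proof (intro CollectI allI impI)
  fix I j assume valid: "valid_problem I" and j: "j < num_jobs I"
  let ?a = "run (flb_policy \<gamma> \<eta> \<beta>) I"
  let ?red = "\<lambda>i. reduced_reward \<gamma> \<eta> \<beta> I ?a i j"
  let ?max = "\<lambda>i. i \<in> nbrs I j \<and> (\<forall>k\<in>nbrs I j. ?red k \<le> ?red i)"
  show "flb_decision \<gamma> \<eta> \<beta> I ?a j"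
  proof (cases "\<exists>i\<in>nbrs I j. ?red i > 0")
    case True
    then have ne: "nbrs I j \<noteq> {}" by auto
    have fin: "finite (nbrs I j)" using valid j by (rule finite_nbrs)
    have "Max (?red ` nbrs I j) \<in> ?red ` nbrs I j" using ne fin by (intro Max_in) auto
    then obtain i where i: "i \<in> nbrs I j" "?red i = Max (?red ` nbrs I j)" by auto
    have "?max i" using i fin by simp
    then have "?max (SOME i. ?max i)" by (rule someI)
    moreover have "?a j = Some (SOME i. ?max i)"
      using run_flb_policy[OF j, of \<gamma> \<eta> \<beta>] True by (simp add: flb_choice_def)
    ultimately show ?thesis using True unfolding flb_decision_def by auto
  next
    case False
    then show ?thesis
      using run_flb_policy[OF j, of \<gamma> \<eta> \<beta>] by (simp add: flb_choice_def flb_decision_def)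
  qed
qed

section \<open>From single instances to the asymptotic ratio\<close>

lemma ereal_divide_le:
  assumes "x \<le> B * y" "y \<ge> 0" "B \<ge> 0"
  shows "ereal x / ereal y \<le> ereal B"
proof (cases "y = 0")
  \<comment> \<open>A zero denominator forces \<open>x \<le> 0\<close>, where the extended quotient
    is 0 or \<open>-\<infinity>\<close>.\<close>
  case True
  then show ?thesis using assms by (cases "x = 0") auto
next
  case False
  then show ?thesis using assms by (simp add: pos_divide_le_eq)
qed

text \<open>The bound of \<open>flb_competitive\<close> depends on the instance only through
  \<open>c_min\<close>, so it bounds the whole supremum; then \<open>\<beta> powr (1 / c)\<close>
  tends to 1.\<close>

lemma flb_asymptotic_guarantee:
  assumes "\<gamma> > 1" "\<eta> > 0" "\<beta> > 1" "R \<ge> 1" "R * D \<le> \<eta> * (\<beta> - 1)"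
    and p: "p \<in> FLB \<gamma> \<eta> \<beta>"
  shows "online_algorithm R D (Deterministic p :: 'w algorithm)"
    and "asymp_ratio (Deterministic p :: 'w algorithm) R D \<le>
      ereal (1 + \<gamma> / (\<gamma> - 1) * ln \<beta> * (1 + \<eta> * (\<gamma> + 1)))"
proof -
  have dec: "flb_decision \<gamma> \<eta> \<beta> I (run p I) j" if "I \<in> problems R D" "j < num_jobs I" for I j
    using p that by (auto simp: FLB_def problems_def)
  have feas: "feasible I (run p I)" if "I \<in> problems R D" for I
    using assms that dec[OF that] by (intro feasible_flb[where \<gamma> = \<gamma> and R = R and D = D]) auto
  then show "online_algorithm R D (Deterministic p :: 'w algorithm)" by simp
  define B where "B c = 1 + \<gamma> / (\<gamma> - 1) * (ln \<beta> * \<beta> powr (1 / real c)) * (1 + \<eta> * (\<gamma> + 1))" for c :: nat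
  have B0: "B c \<ge> 0" for c
    unfolding B_def using assms by (intro add_nonneg_nonneg mult_nonneg_nonneg) auto
  have ratio: "ereal (OPT I) / ereal (ALG (Deterministic p :: 'w algorithm) I) \<le> ereal (B (c_min I))"
    if I: "I \<in> problems R D" for I
  proof (rule ereal_divide_le)
    have valid: "valid_problem I" using I by (simp add: problems_def)
    show "OPT I \<le> B (c_min I) * ALG (Deterministic p :: 'w algorithm) I"
      unfolding OPT_def
    proof (rule cSUP_least)
      show "{a. feasible I a} \<noteq> {}" using feas[OF I] by auto
      fix b assume "b \<in> {a. feasible I a}"
      then show "total_reward I b \<le> B (c_min I) * ALG (Deterministic p :: 'w algorithm) I"
        unfolding B_def ALG.simps using assms dec[OF I] valid by (intro flb_competitive) auto
    qed
    have "(case run p I j of None \<Rightarrow> 0 | Some i \<Rightarrow> rew I i j * dur I i j) \<ge> 0"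
      if "j < num_jobs I" for j
    proof (cases "run p I j")
      case (Some i)
      then have "i \<in> nbrs I j" using feas[OF I] that by (auto simp: feasible_def)
      then have "1 \<le> rew I i j" "1 \<le> dur I i j" using valid that by (auto simp: valid_problem_def)
      then show ?thesis using Some by simp
    qed simp
    then show "ALG (Deterministic p :: 'w algorithm) I \<ge> 0"
      unfolding ALG.simps total_reward_def by (intro sum_nonneg) simp
  qed (rule B0)
  have "B \<longlonglongrightarrow> 1 + \<gamma> / (\<gamma> - 1) * (ln \<beta> * \<beta> powr 0) * (1 + \<eta> * (\<gamma> + 1))"
    unfolding B_def using assms by (intro tendsto_intros lim_1_over_n) auto
  then have "(\<lambda>c. ereal (B c)) \<longlonglongrightarrow> ereal (1 + \<gamma> / (\<gamma> - 1) * ln \<beta> * (1 + \<eta> * (\<gamma> + 1)))"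
    using assms by simp
  then have lim: "limsup (\<lambda>c. ereal (B c)) = ereal (1 + \<gamma> / (\<gamma> - 1) * ln \<beta> * (1 + \<eta> * (\<gamma> + 1)))"
    by (intro lim_imp_Limsup) auto
  show "asymp_ratio (Deterministic p :: 'w algorithm) R D \<le>
      ereal (1 + \<gamma> / (\<gamma> - 1) * ln \<beta> * (1 + \<eta> * (\<gamma> + 1)))"
    unfolding asymp_ratio_def asymp_ratio_on_def lim[symmetric]
    by (intro Limsup_mono always_eventually allI SUP_least) (use ratio in blast)
qed

section \<open>The lower bound\<close>

text \<open>Abel summation: \<open>1 / v k\<close> is the sum of
  \<open>1 / v m - 1 / v (Suc m)\<close> over \<open>k \<le> m < n\<close>, plus
  \<open>1 / v n\<close>.\<close>

lemma sum_by_parts_inverse: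
  fixes v y :: "nat \<Rightarrow> real"
  assumes "\<And>k. v k > 0"
  shows "(\<Sum>k\<le>n. y k) = (\<Sum>m<n. (\<Sum>k\<le>m. v k * y k) * (1 / v m - 1 / v (Suc m))) +
    (\<Sum>k\<le>n. v k * y k) / v n"
proof (induction n)
  case 0
  show ?case using assms[of 0] by simp
next
  case (Suc n)
  let ?S = "\<lambda>m. \<Sum>k\<le>m. v k * y k"
  have "?S n * (1 / v n - 1 / v (Suc n)) + ?S (Suc n) / v (Suc n) = ?S n / v n + y (Suc n)"
    using assms[of "Suc n"] by (simp add: right_diff_distrib add_divide_distrib)
  then show ?case using Suc.IH by (simp only: sum.lessThan_Suc sum.atMost_Suc)
qed

text \<open>Weighting the \<open>m\<close>-th guarantee by \<open>1 / v\<^sub>m - 1 / v\<^sub>m\<^sub>+\<^sub>1\<close> turns the algorithm's rewards into its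
  total capacity usage.\<close>

lemma guarantee_lower_bound:
  fixes v y :: "nat \<Rightarrow> real"
  assumes v: "\<And>k. v k > 0" and mono: "\<And>k. v k \<le> v (Suc k)" and "c > 0" "\<Gamma> \<ge> 0"
    and usage: "(\<Sum>k\<le>N. y k) \<le> c"
    and guarantee: "\<And>n. n \<le> N \<Longrightarrow> c * v n \<le> \<Gamma> * (\<Sum>k\<le>n. v k * y k)"
  shows "1 + (\<Sum>m<N. 1 - v m / v (Suc m)) \<le> \<Gamma>"
proof -
  let ?w = "\<lambda>m. 1 / v m - 1 / v (Suc m)"
  have w: "?w m \<ge> 0" for m using v[of m] v[of "Suc m"] mono[of m] by (simp add: field_simps)
  \<comment> \<open>Guarantee \<open>N\<close> gets the remaining weight \<open>1 / v N\<close> and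
    yields the leading 1.\<close>
  have "c * (1 + (\<Sum>m<N. 1 - v m / v (Suc m))) = (\<Sum>m<N. c * v m * ?w m) + c * v N / v N"
    using v by (simp add: sum_distrib_left algebra_simps less_imp_neq[OF v, symmetric])
  also have "\<dots> \<le> (\<Sum>m<N. \<Gamma> * (\<Sum>k\<le>m. v k * y k) * ?w m) + \<Gamma> * (\<Sum>k\<le>N. v k * y k) / v N"
    using v[of N] w by (intro add_mono sum_mono mult_right_mono divide_right_mono guarantee) auto
  also have "\<dots> = \<Gamma> * ((\<Sum>m<N. (\<Sum>k\<le>m. v k * y k) * ?w m) + (\<Sum>k\<le>N. v k * y k) / v N)"
    by (simp add: distrib_left sum_distrib_left[of \<Gamma> _ "{..<N}"] mult_ac)
  also have "\<dots> = \<Gamma> * (\<Sum>k\<le>N. y k)"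
    using sum_by_parts_inverse[where v = v and y = y and n = N] v by simp
  also have "\<dots> \<le> \<Gamma> * c" using usage \<open>\<Gamma> \<ge> 0\<close> by (rule mult_left_mono)
  finally show ?thesis using \<open>c > 0\<close> by (simp add: mult.commute)
qed

text \<open>A job of total reward \<open>v\<close> on server \<open>0\<close>: rewards up to \<open>D\<close> are realised with per-period reward 1.\<close>

definition value_job :: "real \<Rightarrow> real \<Rightarrow> job" where
  "value_job D v = \<lparr>arrival = 0, offer = [0 \<mapsto> (v / min v D, min v D)]\<rparr>"

definition staircase :: "real \<Rightarrow> (nat \<Rightarrow> real) \<Rightarrow> nat \<Rightarrow> nat \<Rightarrow> problem" where
  "staircase D v c n = \<lparr>capacities = [c], horizon = 0,
     jobs = map (\<lambda>j. value_job D (v (j div c))) [0..<c * Suc n]\<rparr>"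

section \<open>Staircase instances: validity, prefixes and offline value\<close>

lemma staircase_simps:
  "num_servers (staircase D v c n) = 1" "cap (staircase D v c n) 0 = c"
  "num_jobs (staircase D v c n) = c * Suc n" "horizon (staircase D v c n) = 0"
  "c_min (staircase D v c n) = c"
  by (simp_all add: staircase_def num_servers_def cap_def num_jobs_def c_min_def lessThan_Suc)

lemma staircase_job:
  assumes "j < c * Suc n"
  shows "time (staircase D v c n) j = 0" "nbrs (staircase D v c n) j = {0}"
    "rew (staircase D v c n) 0 j = v (j div c) / min (v (j div c)) D"
    "dur (staircase D v c n) 0 j = min (v (j div c)) D"
  using assms
  by (simp_all add: staircase_def time_def nbrs_def rew_def dur_def value_job_def del: mult_Suc_right)

lemma staircase_reward:
  assumes "j < c * Suc n" "v (j div c) > 0" "D > 0"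
  shows "rew (staircase D v c n) 0 j * dur (staircase D v c n) 0 j = v (j div c)"
  using assms by (simp add: staircase_job del: mult_Suc_right)

lemma staircase_in_problems:
  assumes "c \<ge> 1" "R \<ge> 1" "D \<ge> 1" and v: "\<And>k. k \<le> n \<Longrightarrow> 1 \<le> v k \<and> v k \<le> R * D"
  shows "staircase D v c n \<in> single_server_problems R D"
proof -
  have "1 \<le> v (j div c) / min (v (j div c)) D \<and> v (j div c) / min (v (j div c)) D \<le> R \<and>
      1 \<le> min (v (j div c)) D" if "j < c * Suc n" for j
  proof -
    have "j div c < Suc n" using that \<open>c \<ge> 1\<close>
      by (metis less_mult_imp_div_less mult.commute)
    then have "1 \<le> v (j div c)" "v (j div c) \<le> R * D" using v by auto
    then show ?thesis using assms(2,3) by (auto simp: min_def field_simps)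
  qed
  then show ?thesis
    using assms(1) by (auto simp: single_server_problems_def problems_def valid_problem_def
        staircase_simps staircase_job simp del: mult_Suc_right)
qed

text \<open>As all jobs are present at time 0, the capacity constraint there limits the jobs
  accepted from all batches together.\<close>

lemma active_staircase:
  assumes "D \<ge> 1" and v: "\<And>k. v k \<ge> 1"
  shows "active (staircase D v c n) 0 0 = {..<c * Suc n}"
proof -
  have "0 < min (v k) D" for k using \<open>D \<ge> 1\<close> v[of k] by (simp add: less_le_trans[OF zero_less_one])
  then show ?thesis
    by (auto simp: active_def staircase_simps staircase_job simp del: mult_Suc_right)
qed

lemma revealed_staircase:
  assumes "j < c * Suc n" "n \<le> N"
  shows "revealed (staircase D v c n) j = revealed (staircase D v c N) j"
proof -
  have "c * Suc n \<le> c * Suc N" using assms by (intro mult_le_mono) auto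
  then have "Suc j \<le> c * Suc N" using assms by linarith
  then show ?thesis using assms
    by (simp add: revealed_def staircase_def take_map take_upt del: mult_Suc_right upt_Suc)
qed


lemma OPT_staircase_ge:
  assumes "c \<ge> 1" "D \<ge> 1" and v: "\<And>k. v k \<ge> 1"
  shows "OPT (staircase D v c n) \<ge> real c * v n"
proof -
  let ?I = "staircase D v c n"
  have D: "D > 0" using \<open>D \<ge> 1\<close> by simp
  have v0: "v k > 0" for k using v[of k] by simp
  have reward: "(case a j of None \<Rightarrow> 0 | Some i \<Rightarrow> rew ?I i j * dur ?I i j) =
      (if a j = None then 0 else v (j div c))" if "feasible ?I a" "j < c * Suc n" for a j
  proof (cases "a j")
    case (Some i)
    then have "i \<in> nbrs ?I j" using that by (auto simp: feasible_def staircase_simps)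
    then have "i = 0" using that by (simp add: staircase_job del: mult_Suc_right)
    then show ?thesis using Some staircase_reward[of j c n v D] that v0 D
      by (simp del: mult_Suc_right)
  qed simp
  \<comment> \<open>The offline plan fills the server with the last batch and accepts nothing
    else.\<close>
  define a where "a j = (if j div c = n then Some (0::nat) else None)" for j
  have set: "{j. j < c * Suc n \<and> j div c = n} = {c * n..<c * Suc n}"
  proof (intro equalityI subsetI)
    fix j assume "j \<in> {j. j < c * Suc n \<and> j div c = n}"
    then show "j \<in> {c * n..<c * Suc n}" using times_div_less_eq_dividend[of c j] by auto
  next
    fix j assume "j \<in> {c * n..<c * Suc n}"
    then show "j \<in> {j. j < c * Suc n \<and> j div c = n}"
      by (auto intro!: div_nat_eqI simp: mult.commute)
  qed
  have "feasible ?I a"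
    unfolding feasible_def staircase_simps
  proof (intro conjI allI impI)
    fix j i assume "j < c * Suc n" "a j = Some i"
    then show "i \<in> nbrs ?I j"
      by (auto simp: a_def staircase_job simp del: mult_Suc_right split: if_splits)
  next
    fix i t assume "i < (1::nat)"
    then have "{j \<in> active ?I i t. a j = Some i} \<subseteq> {j. j < c * Suc n \<and> j div c = n}"
      by (auto simp: active_def staircase_simps a_def split: if_splits)
    then have "card {j \<in> active ?I i t. a j = Some i} \<le> card {c * n..<c * Suc n}"
      unfolding set by (rule card_mono[rotated]) simp
    then show "card {j \<in> active ?I i t. a j = Some i} \<le> cap ?I i"
      using \<open>i < 1\<close> by (simp add: staircase_simps)
  qed
  moreover have "total_reward ?I a = real c * v n"
  proof -
    have "total_reward ?I a = (\<Sum>j<c * Suc n. if j div c = n then v n else 0)"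
      unfolding total_reward_def staircase_simps
      using reward[OF \<open>feasible ?I a\<close>] by (intro sum.cong) (auto simp: a_def)
    also have "\<dots> = (\<Sum>j | j < c * Suc n \<and> j div c = n. v n)"
      by (simp add: sum.If_cases Int_def del: mult_Suc_right)
    finally show ?thesis unfolding set by simp
  qed
  moreover have "bdd_above (total_reward ?I ` {a. feasible ?I a})"
  proof (rule bdd_aboveI2)
    fix a assume "a \<in> {a. feasible ?I a}"
    then show "total_reward ?I a \<le> (\<Sum>j<c * Suc n. v (j div c))"
      unfolding total_reward_def staircase_simps
      using reward v0 by (intro sum_mono) (auto simp: less_imp_le)
  qed
  ultimately show ?thesis
    unfolding OPT_def by (metis (mono_tags, lifting) cSUP_upper mem_Collect_eq)
qed

lemma total_reward_staircase:
  assumes "\<And>j i. j < c * Suc n \<Longrightarrow> a j = Some i \<Longrightarrow> i = 0" "D \<ge> 1" and v: "\<And>k. v k \<ge> 1"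
  shows "total_reward (staircase D v c n) a = (\<Sum>j<c * Suc n. v (j div c) * of_bool (a j \<noteq> None))"
  unfolding total_reward_def staircase_simps
proof (rule sum.cong)
  fix j assume j: "j \<in> {..<c * Suc n}"
  have "v (j div c) > 0" "D > 0" using v[of "j div c"] assms(2) by auto
  then show "(case a j of None \<Rightarrow> 0 | Some i \<Rightarrow> rew (staircase D v c n) i j * dur (staircase D v c n) i j)
      = v (j div c) * of_bool (a j \<noteq> None)"
    using j assms(1)[of j] staircase_reward[of j c n v D] by (auto simp del: mult_Suc_right split: option.split)
qed simp

lemma feasible_staircase_usage:
  assumes "feasible (staircase D v c n) a" "D \<ge> 1" "\<And>k. v k \<ge> 1"
  shows "\<And>j i. j < c * Suc n \<Longrightarrow> a j = Some i \<Longrightarrow> i = 0"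
    and "(\<Sum>j<c * Suc n. of_bool (a j \<noteq> None)) \<le> real c"
proof -
  show zero: "i = 0" if "j < c * Suc n" "a j = Some i" for i j
  proof -
    have "i \<in> nbrs (staircase D v c n) j"
      using assms(1) that by (auto simp: feasible_def staircase_simps)
    then show ?thesis using that by (simp add: staircase_job del: mult_Suc_right)
  qed
  have "(\<Sum>j<c * Suc n. of_bool (a j \<noteq> None)) = real (card {j \<in> {..<c * Suc n}. a j \<noteq> None})"
    by (simp add: of_bool_def sum.If_cases Int_def del: mult_Suc_right)
  also have "{j \<in> {..<c * Suc n}. a j \<noteq> None} = {j \<in> active (staircase D v c n) 0 0. a j = Some 0}"
    using zero by (auto simp: active_staircase[OF assms(2,3)] simp del: mult_Suc_right)
  also have "real (card \<dots>) \<le> real c"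
    using assms(1) by (simp add: feasible_def staircase_simps)
  finally show "(\<Sum>j<c * Suc n. of_bool (a j \<noteq> None)) \<le> real c" .
qed

text \<open>Each shorter staircase is a prefix of the longest one, so an online algorithm cannot tell them
  apart and a single allocation \<open>x\<close> (in expectation, if randomized) describes all its runs.\<close>

lemma staircase_allocation:
  fixes A :: "'w algorithm"
  assumes A: "online_algorithm R D A" and "c \<ge> 1" "R \<ge> 1" and D: "D \<ge> 1"
    and v: "\<And>k. v k \<ge> 1" and vN: "\<And>k. k \<le> N \<Longrightarrow> v k \<le> R * D"
  shows "\<exists>x. (\<forall>j. x j \<ge> 0) \<and> (\<Sum>j<c * Suc N. x j) \<le> real c \<and>
    (\<forall>n\<le>N. ALG A (staircase D v c n) = (\<Sum>j<c * Suc n. v (j div c) * x j))"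
proof -
  let ?I = "staircase D v c"
  have P: "?I n \<in> problems R D" if "n \<le> N" for n
    using staircase_in_problems[of c R D n v] assms that by (auto simp: single_server_problems_def)
  have mono: "c * Suc n \<le> c * Suc N" if "n \<le> N" for n using that by (intro mult_le_mono) auto
  show ?thesis
  proof (cases A)
    case (Deterministic p)
    have feas: "feasible (?I n) (run p (?I n))" if "n \<le> N" for n
      using A P[OF that] Deterministic by simp
    have "total_reward (?I n) (run p (?I n)) =
        (\<Sum>j<c * Suc n. v (j div c) * of_bool (run p (?I N) j \<noteq> None))" if "n \<le> N" for n
      by (subst total_reward_staircase[OF feasible_staircase_usage(1)[OF feas[OF that] D v] D v])
        (use revealed_staircase[OF _ that] in \<open>auto simp: run_def simp del: mult_Suc_right intro!: sum.cong\<close>)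
    then show ?thesis
      using feasible_staircase_usage(2)[OF feas[OF order_refl] D v] Deterministic
      by (intro exI[of _ "\<lambda>j. of_bool (run p (?I N) j \<noteq> None)"]) auto
  next
    case (Fractional q)
    have feas: "frac_feasible (?I N) (frac_run q (?I N))" using A P[OF order_refl] Fractional by simp
    \<comment> \<open>Feasibility speaks only of jobs of the instance; the cutoff gives
      \<open>x j \<ge> 0\<close> for every \<open>j\<close>.\<close>
    define x where "x j = (if j < c * Suc N then frac_run q (?I N) j 0 else 0)" for j
    have "x j \<ge> 0" for j
      using feas by (auto simp: x_def frac_feasible_def staircase_simps staircase_job simp del: mult_Suc_right)
    moreover have "(\<Sum>j<c * Suc N. x j) \<le> real c"
    proof -
      have "(\<Sum>j<c * Suc N. x j) = (\<Sum>j\<in>active (?I N) 0 0. frac_run q (?I N) j 0)"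
        unfolding active_staircase[OF D v] by (intro sum.cong) (auto simp: x_def)
      also have "\<dots> \<le> real c" using feas by (simp add: frac_feasible_def staircase_simps)
      finally show ?thesis .
    qed
    moreover have "ALG A (?I n) = (\<Sum>j<c * Suc n. v (j div c) * x j)" if "n \<le> N" for n
    proof -
      have "frac_reward (?I n) (frac_run q (?I n)) = (\<Sum>j<c * Suc n. v (j div c) * x j)"
        unfolding frac_reward_def staircase_simps
      proof (rule sum.cong)
        fix j assume "j \<in> {..<c * Suc n}"
        then have j: "j < c * Suc n" by simp
        have "v (j div c) > 0" "D > 0" using v[of "j div c"] D by auto
        moreover have "j < c * Suc N" using j mono[OF that] by linarith
        ultimately show "(\<Sum>i\<in>nbrs (?I n) j. rew (?I n) i j * dur (?I n) i j * frac_run q (?I n) j i) =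
            v (j div c) * x j"
          using j staircase_reward[OF j] revealed_staircase[OF j that]
          by (simp add: staircase_job(2) x_def frac_run_def del: mult_Suc_right)
      qed simp
      then show ?thesis using Fractional by simp
    qed
    ultimately show ?thesis by blast
  next
    case (Randomized M p)
    then interpret prob_space M using A by simp
    have meas: "(\<lambda>w. run (p w) (?I N) j) \<in> measurable M (count_space UNIV)" if "j < c * Suc N" for j
      using A P[OF order_refl] that Randomized by (auto simp: staircase_simps)
    have feas: "AE w in M. feasible (?I N) (run (p w) (?I N))"
      using A P[OF order_refl] Randomized by auto
    \<comment> \<open>Measurability, too, is given only for jobs of the instance. For these,
      \<open>expectation (X j)\<close> is the probability that \<open>j\<close> is accepted.\<close>
    define X where "X j w = (if j < c * Suc N then of_bool (run (p w) (?I N) j \<noteq> None) else 0 :: real)" for j w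
    have X_meas [measurable]: "X j \<in> borel_measurable M" for j
    proof (cases "j < c * Suc N")
      case True
      have "(\<lambda>w. of_bool (run (p w) (?I N) j \<noteq> None) :: real) \<in> borel_measurable M"
        by (rule measurable_compose[OF meas[OF True]]) simp
      then show ?thesis using True unfolding X_def by (simp del: mult_Suc_right)
    qed (simp add: X_def[abs_def] del: mult_Suc_right)
    have X_int: "integrable M (X j)" for j
      by (rule integrable_const_bound[where B = 1]) (auto simp: X_def)
    have "(\<Sum>j<c * Suc N. expectation (X j)) = expectation (\<lambda>w. \<Sum>j<c * Suc N. X j w)"
      using X_int by simp
    also have "\<dots> \<le> expectation (\<lambda>w. real c)"
    proof (rule integral_mono_AE)
      show "AE w in M. (\<Sum>j<c * Suc N. X j w) \<le> real c"
        using feas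
      proof eventually_elim
        case (elim w)
        have "(\<Sum>j<c * Suc N. X j w) = (\<Sum>j<c * Suc N. of_bool (run (p w) (?I N) j \<noteq> None))"
          by (intro sum.cong) (auto simp: X_def)
        then show ?case using feasible_staircase_usage(2)[OF elim D v] by simp
      qed
    qed (use X_int in auto)
    also have "\<dots> = real c" by (simp add: prob_space)
    finally have "(\<Sum>j<c * Suc N. expectation (X j)) \<le> real c" .
    moreover have "expectation (X j) \<ge> 0" for j by (rule Bochner_Integration.integral_nonneg) (auto simp: X_def)
    moreover have "ALG A (?I n) = (\<Sum>j<c * Suc n. v (j div c) * expectation (X j))" if "n \<le> N" for n
    proof -
      \<comment> \<open>Runs are feasible only almost surely, so the linear form of the reward holds
        almost everywhere, which suffices for expectations.\<close>
      have eq: "AE w in M. total_reward (?I n) (run (p w) (?I n)) = (\<Sum>j<c * Suc n. v (j div c) * X j w)"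
        using feas
      proof eventually_elim
        case (elim w)
        have same: "run (p w) (?I n) j = run (p w) (?I N) j" if "j < c * Suc n" for j
          using revealed_staircase[OF that \<open>n \<le> N\<close>] by (simp add: run_def)
        have "i = 0" if "j < c * Suc n" "run (p w) (?I n) j = Some i" for i j
          using feasible_staircase_usage(1)[OF elim D v, of j i] same that mono[OF \<open>n \<le> N\<close>]
          by (simp del: mult_Suc_right)
        then have "total_reward (?I n) (run (p w) (?I n)) =
            (\<Sum>j<c * Suc n. v (j div c) * of_bool (run (p w) (?I n) j \<noteq> None))"
          by (intro total_reward_staircase D v)
        also have "\<dots> = (\<Sum>j<c * Suc n. v (j div c) * X j w)"
          using same less_le_trans[OF _ mono[OF \<open>n \<le> N\<close>]]
          by (intro sum.cong) (auto simp: X_def simp del: mult_Suc_right)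
        finally show ?case .
      qed
      have mn: "(\<lambda>w. total_reward (?I n) (run (p w) (?I n))) \<in> borel_measurable M"
        unfolding total_reward_def
      proof (rule borel_measurable_sum)
        fix j assume "j \<in> {..<num_jobs (?I n)}"
        then have "(\<lambda>w. run (p w) (?I n) j) \<in> measurable M (count_space UNIV)"
          using A P[OF that] Randomized by auto
        then show "(\<lambda>w. case run (p w) (?I n) j of None \<Rightarrow> 0
            | Some i \<Rightarrow> rew (?I n) i j * dur (?I n) i j) \<in> borel_measurable M"
          by (rule measurable_compose) simp
      qed
      have "expectation (\<lambda>w. total_reward (?I n) (run (p w) (?I n))) =
          expectation (\<lambda>w. \<Sum>j<c * Suc n. v (j div c) * X j w)"
        by (rule integral_cong_AE[OF mn _ eq]) simp
      also have "\<dots> = (\<Sum>j<c * Suc n. v (j div c) * expectation (X j))"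
        using X_int by simp
      finally show ?thesis using Randomized by simp
    qed
    ultimately show ?thesis by (intro exI[of _ "\<lambda>j. expectation (X j)"]) auto
  qed
qed

section \<open>From one allocation to the bound \<open>ln (R * D) + 1 / 2\<close>\<close>

lemma sum_blocks:
  fixes g :: "nat \<Rightarrow> 'a :: comm_monoid_add"
  shows "(\<Sum>j<c * Suc n. g j) = (\<Sum>k\<le>n. \<Sum>j\<in>{c * k..<c * Suc k}. g j)"
proof (induction n)
  case (Suc n)
  have "(\<Sum>j<c * Suc n. g j) + (\<Sum>j\<in>{c * Suc n..<c * Suc (Suc n)}. g j) =
      (\<Sum>j<c * Suc (Suc n). g j)"
    unfolding lessThan_atLeast0 by (rule sum.atLeastLessThan_concat) simp_all
  then show ?case by (simp only: Suc.IH sum.atMost_Suc)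
qed (simp add: atLeast0LessThan)

text \<open>Already at a fixed capacity, values rising geometrically from 1 to \<open>R * D\<close>
  in \<open>N\<close> steps force \<open>\<Gamma> \<ge> 1 + N * (1 - exp (- L / N))\<close>, which
  approaches \<open>1 + L\<close>; an error of 1/2 is allowed.\<close>

lemma competitive_ratio_lower_bound:
  fixes A :: "'w algorithm"
  assumes A: "online_algorithm R D A" and "c \<ge> 1" "R \<ge> 1" "D \<ge> 1"
    and ratio: "\<And>I. I \<in> single_server_problems R D \<Longrightarrow> c_min I = c \<Longrightarrow>
      ereal (OPT I) / ereal (ALG A I) \<le> ereal \<Gamma>"
  shows "ln (R * D) + 1 / 2 \<le> \<Gamma>"
proof -
  define L where "L = ln (R * D)"
  have RD: "R * D \<ge> 1" using assms(3,4) by (rule mult_ge1_I)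
  then have L0: "L \<ge> 0" by (simp add: L_def)
  \<comment> \<open>The discretization error is at most \<open>L\<^sup>2 / N\<close>, hence at most
    1/2; \<open>Suc\<close> keeps \<open>N\<close> positive when \<open>L = 0\<close>.\<close>
  define N where "N = Suc (nat \<lceil>2 * L\<^sup>2\<rceil>)"
  have N: "real N \<ge> 2 * L\<^sup>2" "real N > 0" unfolding N_def by linarith+
  define v where "v k = exp (L * real k / real N)" for k
  have v: "v k \<ge> 1" for k using L0 N by (simp add: v_def)
  have v0: "v k > 0" for k by (simp add: v_def)
  have vN: "v k \<le> R * D" if "k \<le> N" for k
  proof -
    have "L * real k / real N \<le> L * real N / real N"
      using that L0 by (intro divide_right_mono mult_left_mono) auto
    then have "v k \<le> exp L" using N by (simp add: v_def)
    then show ?thesis using RD by (simp add: L_def)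
  qed
  obtain x where x0: "\<And>j. x j \<ge> 0" and xc: "(\<Sum>j<c * Suc N. x j) \<le> real c" and
    ALG: "\<And>n. n \<le> N \<Longrightarrow> ALG A (staircase D v c n) = (\<Sum>j<c * Suc n. v (j div c) * x j)"
    using staircase_allocation[OF A assms(2-4), of v N] v vN by metis
  define y where "y k = (\<Sum>j\<in>{c * k..<c * Suc k}. x j)" for k
  have blocks: "(\<Sum>j<c * Suc n. v (j div c) * x j) = (\<Sum>k\<le>n. v k * y k)" for n
  proof -
    have "j div c = k" if "j \<in> {c * k..<c * Suc k}" for j k
      using that by (intro div_nat_eqI) (auto simp: mult.commute)
    then show ?thesis
      unfolding sum_blocks y_def sum_distrib_left by (intro sum.cong) auto
  qed
  have guarantee: "real c * v n \<le> \<Gamma> * (\<Sum>k\<le>n. v k * y k)" and \<Gamma>0: "\<Gamma> \<ge> 0" if "n \<le> N" for n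
  proof -
    let ?I = "staircase D v c n"
    have "?I \<in> single_server_problems R D"
      using staircase_in_problems[of c R D n v] assms v vN that by auto
    then have r: "ereal (OPT ?I) / ereal (ALG A ?I) \<le> ereal \<Gamma>"
      using ratio by (simp add: staircase_simps)
    have opt: "real c * v n \<le> OPT ?I" using assms v by (intro OPT_staircase_ge) auto
    moreover have "real c * v n > 0" using \<open>c \<ge> 1\<close> v0 by simp
    ultimately have "OPT ?I > 0" by linarith
    moreover have alg: "ALG A ?I = (\<Sum>k\<le>n. v k * y k)" using ALG[OF that] blocks by simp
    moreover have "(\<Sum>k\<le>n. v k * y k) \<ge> 0"
      unfolding y_def using x0 v0 by (intro sum_nonneg mult_nonneg_nonneg) (auto simp: less_imp_le)
    \<comment> \<open>With a positive optimum and reward 0 the quotient would be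
      \<open>\<infinity>\<close>.\<close>
    ultimately have "ALG A ?I > 0" using r
      by (cases "ALG A ?I = 0") (auto simp: ereal_divide_eq)
    then have "OPT ?I / ALG A ?I \<le> \<Gamma>" using r by simp
    moreover have "OPT ?I / ALG A ?I \<ge> 0" using \<open>ALG A ?I > 0\<close> \<open>OPT ?I > 0\<close> by simp
    ultimately have "0 \<le> \<Gamma>" "OPT ?I \<le> \<Gamma> * ALG A ?I"
      using \<open>ALG A ?I > 0\<close> by (linarith, simp add: pos_divide_le_eq)
    then show "real c * v n \<le> \<Gamma> * (\<Sum>k\<le>n. v k * y k)" "\<Gamma> \<ge> 0" using opt alg by auto
  qed
  have "1 + (\<Sum>m<N. 1 - v m / v (Suc m)) \<le> \<Gamma>"
  proof (rule guarantee_lower_bound[where c = "real c" and y = y])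
    show "v k \<le> v (Suc k)" for k using L0 by (simp add: v_def divide_right_mono mult_left_mono)
    show "(\<Sum>k\<le>N. y k) \<le> real c" using xc unfolding sum_blocks y_def .
  qed (use v0 guarantee \<Gamma>0[of 0] \<open>c \<ge> 1\<close> in auto)
  moreover have "v m / v (Suc m) = exp (- (L / real N))" for m
    by (simp add: v_def add_divide_distrib algebra_simps flip: exp_diff)
  ultimately have "1 + real N * (1 - exp (- (L / real N))) \<le> \<Gamma>" by simp
  moreover have "L - 1 / 2 \<le> real N * (1 - exp (- (L / real N)))"
  proof -
    let ?z = "L / real N"
    have z: "?z \<ge> 0" using L0 by simp
    \<comment> \<open>This identity turns \<open>exp (- z) \<le> 1 / (1 + z)\<close> into a
      quadratic upper bound.\<close>
    have "(1 - z + z\<^sup>2) * (1 + z) = 1 + z ^ 3" for z :: real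
      by (simp add: algebra_simps power2_eq_square power3_eq_cube)
    note this[of ?z]
    moreover have "?z ^ 3 \<ge> 0" using z by (rule zero_le_power)
    ultimately have "1 / (1 + ?z) \<le> 1 - ?z + ?z\<^sup>2" using z by (simp add: divide_le_eq)
    moreover have "exp (- ?z) \<le> 1 / (1 + ?z)"
      unfolding exp_minus' using z exp_ge_add_one_self[of ?z] by (intro divide_left_mono) auto
    ultimately have "exp (- ?z) \<le> 1 - ?z + ?z\<^sup>2" by linarith
    then have "real N * (?z - ?z\<^sup>2) \<le> real N * (1 - exp (- ?z))" by (intro mult_left_mono) auto
    moreover have "real N * (?z - ?z\<^sup>2) = L - L\<^sup>2 / real N"
      using N by (simp add: field_simps power2_eq_square)
    moreover have "L\<^sup>2 / real N \<le> 1 / 2" using N by (simp add: field_simps)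
    ultimately show ?thesis by linarith
  qed
  ultimately show ?thesis unfolding L_def by linarith
qed

lemma asymp_ratio_single_server_ge:
  fixes A :: "'w algorithm"
  assumes "online_algorithm R D A" "R \<ge> 1" "D \<ge> 1"
  shows "ereal (ln (R * D) + 1 / 2) \<le> asymp_ratio_on (single_server_problems R D) A"
proof -
  let ?s = "\<lambda>c. SUP I\<in>{I \<in> single_server_problems R D. c_min I = c}. ereal (OPT I) / ereal (ALG A I)"
  have "ereal (ln (R * D) + 1 / 2) \<le> ?s c" if "c \<ge> 1" for c
  \<comment> \<open>It suffices to compare with real upper bounds \<open>\<Gamma>\<close> of the
    supremum.\<close>
  proof (rule ereal_le_real)
    fix \<Gamma> assume "?s c \<le> ereal \<Gamma>"
    then have "ereal (OPT I) / ereal (ALG A I) \<le> ereal \<Gamma>"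
      if "I \<in> single_server_problems R D" "c_min I = c" for I
      unfolding SUP_le_iff using that by blast
    then have "ln (R * D) + 1 / 2 \<le> \<Gamma>"
      using assms that by (intro competitive_ratio_lower_bound)
    then show "ereal (ln (R * D) + 1 / 2) \<le> ereal \<Gamma>" by simp
  qed
  then have "eventually (\<lambda>c. ereal (ln (R * D) + 1 / 2) \<le> ?s c) sequentially"
    by (auto simp: eventually_sequentially)
  then show ?thesis
    unfolding asymp_ratio_on_def by (intro le_Limsup) auto
qed

section \<open>The logarithmic rate\<close>

text \<open>Of order \<open>ln (R * D)\<close>, so that
  \<open>\<gamma> / (\<gamma> - 1) = 1 + O(1 / \<gamma>)\<close> adds only O(1) to
  \<open>ln \<beta> = O(\<gamma>)\<close>; the summand 2 keeps \<open>\<gamma>\<close> away from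
  1.\<close>

definition flb_gamma :: "real \<Rightarrow> real \<Rightarrow> real" where
  "flb_gamma R D = 2 + ln (R * D)"

text \<open>Small enough that \<open>1 + \<eta> * (\<gamma> + 1)\<close> is
  \<open>1 + O(1 / \<gamma>)\<close> as well, yet raising \<open>ln \<beta>\<close> by only about
  \<open>2 * ln \<gamma>\<close>.\<close>

definition flb_eta :: "real \<Rightarrow> real \<Rightarrow> real" where
  "flb_eta R D = 1 / (flb_gamma R D)\<^sup>2"

text \<open>The least \<open>\<beta>\<close> with \<open>\<Psi>(0) \<ge> R D\<close>, so that a full server never looks attractive.\<close>

definition flb_beta :: "real \<Rightarrow> real \<Rightarrow> real" where
  "flb_beta R D = 1 + R * D * (flb_gamma R D)\<^sup>2"

lemma flb_parameters:
  assumes "R \<ge> 1" "D \<ge> 1"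
  shows "flb_gamma R D \<ge> 2" "flb_eta R D > 0" "flb_beta R D > 1"
    "R * D \<le> flb_eta R D * (flb_beta R D - 1)"
proof -
  have RD: "R * D \<ge> 1" using assms by (rule mult_ge1_I)
  then show g: "flb_gamma R D \<ge> 2" by (simp add: flb_gamma_def)
  then show "flb_eta R D > 0" by (simp add: flb_eta_def)
  have "R * D * (flb_gamma R D)\<^sup>2 > 0" using assms g by simp
  then show "flb_beta R D > 1" by (simp add: flb_beta_def)
  show "R * D \<le> flb_eta R D * (flb_beta R D - 1)"
    using g by (simp add: flb_eta_def flb_beta_def)
qed

lemma flb_constant_bound:
  assumes "R \<ge> 1" "D \<ge> 1"
  defines "\<gamma> \<equiv> flb_gamma R D"
  shows "1 + \<gamma> / (\<gamma> - 1) * ln (flb_beta R D) * (1 + flb_eta R D * (\<gamma> + 1)) \<le>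
    ln (R * D) + 3 * ln (max 1 (ln (max R D))) + (26 + 2 * ln 4)"
proof -
  define x where "x = ln (R * D)"
  have RD: "R * D \<ge> 1" using assms(1,2) by (rule mult_ge1_I)
  have x: "x \<ge> 0" using RD by (simp add: x_def)
  have \<gamma>: "\<gamma> = 2 + x" by (simp add: \<gamma>_def flb_gamma_def x_def)
  then have \<gamma>2: "\<gamma> \<ge> 2" using x by simp
  \<comment> \<open>The cutoff at 1 keeps \<open>ln M\<close> nonnegative, so that
    \<open>2 * ln M\<close> may be relaxed to \<open>3 * ln M\<close> at the end.\<close>
  define M where "M = max 1 (ln (max R D))"
  have M: "M \<ge> 1" by (simp add: M_def)
  have "x = ln R + ln D" using assms by (simp add: x_def ln_mult)
  moreover have "ln R \<le> ln (max R D)" "ln D \<le> ln (max R D)" using assms by auto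
  ultimately have "x \<le> 2 * M" unfolding M_def by linarith
  then have "\<gamma> \<le> 4 * M" using \<gamma> M by linarith
  then have "ln \<gamma> \<le> ln (4 * M)" using \<gamma>2 by simp
  then have ln\<gamma>: "ln \<gamma> \<le> ln 4 + ln M" using M by (simp add: ln_mult)
  have lnM: "ln M \<ge> 0" using M by simp
  have lb: "ln (flb_beta R D) \<le> x + 2 * ln \<gamma> + 1"
  proof -
    have "1 \<le> R * D * \<gamma>\<^sup>2" by (rule mult_ge1_I[OF RD]) (use \<gamma>2 in \<open>simp add: one_le_power\<close>)
    then have "flb_beta R D \<le> 2 * (R * D * \<gamma>\<^sup>2)" unfolding flb_beta_def \<gamma>_def by linarith
    then have "ln (flb_beta R D) \<le> ln (2 * (R * D * \<gamma>\<^sup>2))"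
      using flb_parameters(3)[OF assms(1,2)] by simp
    also have "\<dots> = ln 2 + x + 2 * ln \<gamma>"
      using RD \<gamma>2 assms by (simp add: ln_mult x_def ln_realpow)
    finally show ?thesis using ln_2_less_1 by linarith
  qed
  have lb4: "ln (flb_beta R D) \<le> 4 * \<gamma>"
  proof -
    have "ln \<gamma> \<le> \<gamma> - 1" using \<gamma>2 by (intro ln_le_minus_one) auto
    then show ?thesis using lb \<gamma> x by linarith
  qed
  have lb0: "ln (flb_beta R D) \<ge> 0" using flb_parameters(3)[OF assms(1,2)] by simp
  \<comment> \<open>Each of the two factors is at most \<open>1 + 2 / \<gamma>\<close>, and
    \<open>4 / \<gamma>\<^sup>2 \<le> 2 / \<gamma>\<close> as
    \<open>\<gamma> \<ge> 2\<close>.\<close>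
  have factor: "\<gamma> / (\<gamma> - 1) * (1 + flb_eta R D * (\<gamma> + 1)) \<le> 1 + 6 / \<gamma>"
  proof -
    have "\<gamma> / (\<gamma> - 1) \<le> 1 + 2 / \<gamma>" using \<gamma>2 by (simp add: field_simps)
    moreover have "1 + flb_eta R D * (\<gamma> + 1) \<le> 1 + 2 / \<gamma>"
      using \<gamma>2 by (simp add: flb_eta_def \<gamma>_def[symmetric] field_simps power2_eq_square)
    ultimately have "\<gamma> / (\<gamma> - 1) * (1 + flb_eta R D * (\<gamma> + 1)) \<le> (1 + 2 / \<gamma>) * (1 + 2 / \<gamma>)"
      using \<gamma>2 flb_parameters(2)[OF assms(1,2)] by (intro mult_mono) auto
    also have "\<dots> \<le> 1 + 6 / \<gamma>" using \<gamma>2 by (simp add: field_simps)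
    finally show ?thesis .
  qed
  have "\<gamma> / (\<gamma> - 1) * ln (flb_beta R D) * (1 + flb_eta R D * (\<gamma> + 1)) =
      \<gamma> / (\<gamma> - 1) * (1 + flb_eta R D * (\<gamma> + 1)) * ln (flb_beta R D)" by simp
  also have "\<dots> \<le> (1 + 6 / \<gamma>) * ln (flb_beta R D)" by (rule mult_right_mono[OF factor lb0])
  also have "\<dots> = ln (flb_beta R D) + 6 * (ln (flb_beta R D) / \<gamma>)" by (simp add: algebra_simps)
  also have "\<dots> \<le> (x + 2 * ln \<gamma> + 1) + 6 * 4"
    using lb lb4 \<gamma>2 by (intro add_mono mult_left_mono) (auto simp: pos_divide_le_eq)
  \<comment> \<open>The 26 collects the initial 1, the 1 in the bound on \<open>ln \<beta>\<close>,
    and 24 from \<open>6 / \<gamma>\<close> times \<open>4 * \<gamma>\<close>;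
    \<open>2 * ln 4\<close> stems from \<open>\<gamma> \<le> 4 * M\<close>.\<close>
  finally show ?thesis using ln\<gamma> lnM unfolding x_def[symmetric] M_def[symmetric] by linarith
qed

lemma flb_log_guarantee:
  assumes "R \<ge> 1" "D \<ge> 1" "p \<in> FLB (flb_gamma R D) (flb_eta R D) (flb_beta R D)"
  shows "online_algorithm R D (Deterministic p :: 'w algorithm)"
    and "asymp_ratio (Deterministic p :: 'w algorithm) R D \<le>
      ereal (ln (R * D) + 3 * ln (max 1 (ln (max R D))) + (26 + 2 * ln 4))"
proof -
  note par = flb_parameters[OF assms(1,2)]
  have "flb_gamma R D > 1" using par(1) by simp
  note guarantee = flb_asymptotic_guarantee[OF this par(2,3) assms(1) par(4) assms(3)]
  show "online_algorithm R D (Deterministic p :: 'w algorithm)" by (rule guarantee(1))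
  show "asymp_ratio (Deterministic p :: 'w algorithm) R D \<le>
      ereal (ln (R * D) + 3 * ln (max 1 (ln (max R D))) + (26 + 2 * ln 4))"
    by (rule order_trans[OF guarantee(2)]) (use flb_constant_bound[OF assms(1,2)] in simp)
qed

section \<open>Logarithmic rates and the limit constants\<close>

lemma asymp_ratio_ge:
  fixes A :: "'w algorithm"
  assumes "online_algorithm R D A" "R \<ge> 1" "D \<ge> 1"
  shows "ereal (ln (R * D)) \<le> asymp_ratio A R D"
proof -
  have "ereal (ln (R * D)) \<le> ereal (ln (R * D) + 1 / 2)" by simp
  also have "\<dots> \<le> asymp_ratio_on (single_server_problems R D) A"
    using assms by (rule asymp_ratio_single_server_ge)
  also have "\<dots> \<le> asymp_ratio A R D"
    unfolding asymp_ratio_def asymp_ratio_on_def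
    by (intro Limsup_mono always_eventually allI SUP_subset_mono) (auto simp: single_server_problems_def)
  finally show ?thesis .
qed

lemma has_log_rate_ge_1:
  assumes ge: "\<And>R D. R \<ge> 1 \<Longrightarrow> D \<ge> 1 \<Longrightarrow> ereal (ln (R * D)) \<le> \<Gamma> R D"
    and rate: "has_log_rate \<Gamma> C"
  shows "C \<ge> 1"
proof (rule ccontr)
  assume "\<not> C \<ge> 1"
  \<comment> \<open>Half of the gap between \<open>C\<close> and 1, too small an error to lift
    \<open>C * ln (R * D)\<close> to \<open>ln (R * D)\<close>.\<close>
  define \<epsilon> where "\<epsilon> = (1 - C) / 2"
  have "\<epsilon> > 0" using \<open>\<not> C \<ge> 1\<close> by (simp add: \<epsilon>_def)
  then obtain X where X: "\<And>R D. R \<ge> 1 \<Longrightarrow> D \<ge> 1 \<Longrightarrow> R * D \<ge> X \<Longrightarrow>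
      \<bar>\<Gamma> R D - ereal (C * ln (R * D))\<bar> \<le> ereal (\<epsilon> * ln (R * D))"
    using rate unfolding has_log_rate_def by blast
  \<comment> \<open>With \<open>D = 1\<close> the product is \<open>R\<close> itself; the 2 makes
    \<open>ln R\<close> positive.\<close>
  define R where "R = max X 2"
  have R: "R \<ge> 2" "R \<ge> X" by (auto simp: R_def)
  then have L: "ln R > 0" by simp
  have "\<bar>\<Gamma> R 1 - ereal (C * ln R)\<bar> \<le> ereal (\<epsilon> * ln R)" using X[of R 1] R by simp
  moreover have "ereal (ln R) \<le> \<Gamma> R 1" using ge[of R 1] R by simp
  ultimately have "ln R - C * ln R \<le> \<epsilon> * ln R" by (cases "\<Gamma> R 1") auto
  then have "(1 - C) * ln R \<le> \<epsilon> * ln R" by (simp add: algebra_simps)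
  then have "1 - C \<le> \<epsilon>" using L by (simp add: mult_le_cancel_right)
  then show False using \<open>\<epsilon> > 0\<close> by (simp add: \<epsilon>_def)
qed

text \<open>Rests on \<open>ln y / y\<close> tending to 0; \<open>y\<close> stands for
  \<open>ln (R * D)\<close>.\<close>

lemma loglog_negligible:
  assumes "\<epsilon> > 0"
  shows "\<exists>X. \<forall>y\<ge>X. 3 * ln (max 1 y) + K \<le> \<epsilon> * (y :: real)"
proof -
  have "((\<lambda>y::real. 3 * (ln y / y) + K * (1 / y)) \<longlongrightarrow> 3 * 0 + K * 0) at_top"
    by (intro tendsto_intros lim_1_over_real_power ln_x_over_x_tendsto_0) (rule tendsto_divide_0, auto intro: filterlim_at_top_imp_at_infinity filterlim_ident)
  then have "eventually (\<lambda>y::real. 3 * (ln y / y) + K * (1 / y) < \<epsilon>) at_top"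
    using assms by (intro order_tendstoD(2)[where y = "3 * 0 + K * 0"]) auto
  then have "eventually (\<lambda>y::real. 3 * ln (max 1 y) + K \<le> \<epsilon> * y) at_top"
    using eventually_ge_at_top[of 1]
  proof eventually_elim
    case (elim y)
    then have "(3 * (ln y / y) + K * (1 / y)) * y \<le> \<epsilon> * y" by (intro mult_right_mono) auto
    then show ?case using elim by (simp add: distrib_right max_def)
  qed
  then show ?thesis by (simp add: eventually_at_top_linorder)
qed

lemma has_log_rate_1:
  assumes ge: "\<And>R D. R \<ge> 1 \<Longrightarrow> D \<ge> 1 \<Longrightarrow> ereal (ln (R * D)) \<le> \<Gamma> R D"
    and le: "\<And>R D. R \<ge> 1 \<Longrightarrow> D \<ge> 1 \<Longrightarrow>
      \<Gamma> R D \<le> ereal (ln (R * D) + 3 * ln (max 1 (ln (max R D))) + K)"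
  shows "has_log_rate \<Gamma> 1"
  unfolding has_log_rate_def
proof (intro allI impI)
  fix \<epsilon> :: real assume "\<epsilon> > 0"
  then obtain Y where Y: "\<And>y. y \<ge> Y \<Longrightarrow> 3 * ln (max 1 y) + K \<le> \<epsilon> * y"
    using loglog_negligible by blast
  show "\<exists>X. \<forall>R\<ge>1. \<forall>D\<ge>1. R * D \<ge> X \<longrightarrow>
      \<bar>\<Gamma> R D - ereal (1 * ln (R * D))\<bar> \<le> ereal (\<epsilon> * ln (R * D))"
  proof (intro exI[of _ "exp Y"] allI impI)
    fix R D :: real assume R: "R \<ge> 1" and D: "D \<ge> 1" and RD: "R * D \<ge> exp Y"
    have "R * D > 0" using R D by simp
    then have "ln (R * D) \<ge> Y" using RD by (simp add: ln_ge_iff)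
    then have "3 * ln (max 1 (ln (R * D))) + K \<le> \<epsilon> * ln (R * D)" by (rule Y)
    \<comment> \<open>As \<open>max R D \<le> R * D\<close>, the error is bounded in terms of the
      product alone, so one threshold serves all \<open>R\<close> and \<open>D\<close>.\<close>
    moreover have "ln (max 1 (ln (max R D))) \<le> ln (max 1 (ln (R * D)))"
    proof -
      have "max R D \<le> R * D" using R D mult_left_mono[of 1 D R] mult_right_mono[of 1 R D] by auto
      then have "ln (max R D) \<le> ln (R * D)" using R by (intro ln_mono) auto
      then show ?thesis by (intro ln_mono) auto
    qed
    ultimately show "\<bar>\<Gamma> R D - ereal (1 * ln (R * D))\<bar> \<le> ereal (\<epsilon> * ln (R * D))"
      using ge[OF R D] le[OF R D] by (cases "\<Gamma> R D") (simp_all del: ln_le_cancel_iff)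
  qed
qed

text \<open>A family without any logarithmic rate is covered too: the infimum of the empty set is
  \<open>\<infinity>\<close>.\<close>

lemma C_log_limit_ge_1:
  fixes A :: "real \<Rightarrow> real \<Rightarrow> 'w algorithm"
  assumes "\<And>R D. R \<ge> 1 \<Longrightarrow> D \<ge> 1 \<Longrightarrow> online_algorithm R D (A R D)"
  shows "C_log_limit A \<ge> 1"
  unfolding C_log_limit_def
proof (rule Inf_greatest)
  fix z assume "z \<in> {ereal C |C. C > 0 \<and> has_log_rate (\<lambda>R D. asymp_ratio (A R D) R D) C}"
  then obtain C where z: "z = ereal C" and C: "has_log_rate (\<lambda>R D. asymp_ratio (A R D) R D) C"
    by auto
  have "C \<ge> 1" by (rule has_log_rate_ge_1[OF asymp_ratio_ge[OF assms] C])
  then show "1 \<le> z" using z by simp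
qed

lemma C_log_limit_FLB:
  assumes F: "\<And>R D. R \<ge> 1 \<Longrightarrow> D \<ge> 1 \<Longrightarrow> F R D \<in> FLB (flb_gamma R D) (flb_eta R D) (flb_beta R D)"
  shows "C_log_limit (\<lambda>R D. Deterministic (F R D) :: 'w algorithm) = 1"
proof (rule antisym)
  note flb = flb_log_guarantee[OF _ _ F]
  have "has_log_rate (\<lambda>R D. asymp_ratio (Deterministic (F R D) :: 'w algorithm) R D) 1"
    by (rule has_log_rate_1[where K = "26 + 2 * ln 4"])
      (use flb asymp_ratio_ge in blast)+
  then show "C_log_limit (\<lambda>R D. Deterministic (F R D) :: 'w algorithm) \<le> 1"
    unfolding C_log_limit_def by (intro Inf_lower) (auto simp: one_ereal_def)
  show "1 \<le> C_log_limit (\<lambda>R D. Deterministic (F R D) :: 'w algorithm)"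
    by (rule C_log_limit_ge_1) (rule flb(1))
qed

lemma C_log_limit_star_eq_1: "C_log_limit_star TYPE('w) = 1"
proof (rule antisym)
  let ?F = "\<lambda>R D. Deterministic (flb_policy (flb_gamma R D) (flb_eta R D) (flb_beta R D)) :: 'w algorithm"
  have "C_log_limit_star TYPE('w) \<le> C_log_limit ?F"
    unfolding C_log_limit_star_def
    by (rule INF_lower) (use flb_log_guarantee(1) flb_policy_in_FLB in blast)
  also have "\<dots> = 1" by (rule C_log_limit_FLB) (rule flb_policy_in_FLB)
  finally show "C_log_limit_star TYPE('w) \<le> 1" .
  show "1 \<le> C_log_limit_star TYPE('w)"
    unfolding C_log_limit_star_def by (intro INF_greatest C_log_limit_ge_1) auto
qed

theorem theorem1:
  shows "\<exists>(\<gamma> :: real \<Rightarrow> real \<Rightarrow> real) (\<eta> :: real \<Rightarrow> real \<Rightarrow> real) (\<beta> :: real \<Rightarrow> real \<Rightarrow> real).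
      (\<forall>R\<ge>1. \<forall>D\<ge>1. \<gamma> R D \<ge> 1 \<and> \<eta> R D \<ge> 0 \<and> \<beta> R D \<ge> 1 \<and>
         FLB (\<gamma> R D) (\<eta> R D) (\<beta> R D) \<noteq> {}) \<and>
      (\<exists>K. \<forall>R\<ge>1. \<forall>D\<ge>1. \<forall>p\<in>FLB (\<gamma> R D) (\<eta> R D) (\<beta> R D).
         online_algorithm R D (Deterministic p :: 'w algorithm) \<and>
         asymp_ratio (Deterministic p :: 'w algorithm) R D
           \<le> ereal (ln (R * D) + 3 * ln (max 1 (ln (max R D))) + K)) \<and>
      (\<exists>\<kappa>>0. \<forall>R\<ge>1. \<forall>D\<ge>1. \<forall>A :: 'w algorithm. online_algorithm R D A \<longrightarrow>
         asymp_ratio_on (single_server_problems R D) A \<ge> ereal (ln (R * D) + \<kappa>)) \<and>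
      (\<forall>F. (\<forall>R\<ge>1. \<forall>D\<ge>1. F R D \<in> FLB (\<gamma> R D) (\<eta> R D) (\<beta> R D)) \<longrightarrow>
         C_log_limit (\<lambda>R D. Deterministic (F R D) :: 'w algorithm) = 1) \<and>
      C_log_limit_star TYPE('w) = 1"
proof (rule exI[of _ flb_gamma], rule exI[of _ flb_eta], rule exI[of _ flb_beta], intro conjI allI impI)
  fix R D :: real assume RD: "R \<ge> 1" "D \<ge> 1"
  show "flb_gamma R D \<ge> 1" "flb_eta R D \<ge> 0" "flb_beta R D \<ge> 1"
    using flb_parameters[OF RD] by auto
  show "FLB (flb_gamma R D) (flb_eta R D) (flb_beta R D) \<noteq> {}"
    using flb_policy_in_FLB by blast
next
  show "\<exists>K. \<forall>R\<ge>1. \<forall>D\<ge>1. \<forall>p\<in>FLB (flb_gamma R D) (flb_eta R D) (flb_beta R D).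
         online_algorithm R D (Deterministic p :: 'w algorithm) \<and>
         asymp_ratio (Deterministic p :: 'w algorithm) R D
           \<le> ereal (ln (R * D) + 3 * ln (max 1 (ln (max R D))) + K)"
    using flb_log_guarantee by (intro exI[of _ "26 + 2 * ln 4"]) blast
next
  show "\<exists>\<kappa>>0. \<forall>R\<ge>1. \<forall>D\<ge>1. \<forall>A :: 'w algorithm. online_algorithm R D A \<longrightarrow>
         asymp_ratio_on (single_server_problems R D) A \<ge> ereal (ln (R * D) + \<kappa>)"
    using asymp_ratio_single_server_ge by (intro exI[of _ "1 / 2"]) auto
next
  fix F assume "\<forall>R\<ge>1. \<forall>D\<ge>1. F R D \<in> FLB (flb_gamma R D) (flb_eta R D) (flb_beta R D)"
  then show "C_log_limit (\<lambda>R D. Deterministic (F R D) :: 'w algorithm) = 1"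
    by (intro C_log_limit_FLB) auto
next
  show "C_log_limit_star TYPE('w) = 1" by (rule C_log_limit_star_eq_1)
qed

end
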